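(* Let $X$ be a complex manifold, let $r$ be a positive integer, let $f_{1},\dots,f_{r-1}\in C^{\infty}(X,\mathbb{C})$ and $\sigma\in C^{\infty}(X,\mathbb{R})$, and let $E_{r}=X\times\mathbb{C}^{r}$ be the trivial rank $r$ holomorphic vector bundle over $X$ with the Hermitian metric $$h=g^{*}g,\qquad g=\begin{pmatrix} 1 & 0 & 0 & \dots &0 & \bar{f}_{1} \\ 0 & 1 & 0 & \dots & 0 & \bar{f}_{2} \\ 0 & 0 & 1 & \dots & 0 & \bar{f}_{3}\\ \vdots & \vdots & \vdots &\ddots &\vdots &\vdots \\ 0 & 0 & 0 & \dots & 1& \bar{f}_{r-1}\\ 0 & 0 & 0 & \dots & 0 & e^{\sigma/2} \end{pmatrix}.$$ Put $U=e^{-\sigma}\sum_{i=1}^{r-1}\partial f_i\wedge\bar\partial\bar f_i$, and let $E_1=\det E_r$, a trivial line bundle over $X$. Then $$c(E_{r},h)=c(E_{1},e^{\sigma})+\frac{\sqrt{-1}}{2\pi}\,\bar\partial\partial\log\left(1-\frac{\sqrt{-1}}{2\pi}\,U\right).$$ Equivalently, $$c_{1}(E_{r},h)=\frac{\sqrt{-1}}{2\pi}\,\bar\partial\partial\sigma,\qquad c_{k}(E_{r},h)=-\frac{1}{k-1}\left(\frac{\sqrt{-1}}{2\pi}\right)^{k}\bar\partial\partial\,U^{k-1},\quad k=2,\dots,r.$$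
   Context: Here $g^{*}$ is the conjugate transpose of $g$. For a holomorphic vector bundle $E$ of rank $r$ with Hermitian metric $h$, the canonical connection is $d+h^{-1}\partial h$ in a holomorphic trivialization, its curvature is $\Theta=\bar\partial(h^{-1}\partial h)$, and the total Chern form is $c(E,h)=\det\left(I+\frac{\sqrt{-1}}{2\pi}\Theta\right)=\sum_{k=0}^{r}c_k(E,h)$, with $c_k(E,h)$ of type $(k,k)$. $c(E_1,e^\sigma)$ is the total Chern form of the trivial line bundle with metric $e^{\sigma}$. Powers of $U$ are wedge powers, and for a nilpotent element $a$ one sets $-\log(1-a)=a+\frac{a^2}{2}+\frac{a^3}{3}+\cdots$ (a finite sum). *)

theory Defs
  imports
    "HOL-Analysis.Analysis"
    "Jordan_Normal_Form.Schur_Decomposition"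
    "Jordan_Normal_Form.Gauss_Jordan_Elimination"
begin

section \<open>Complex manifolds and smooth functions\<close>

text \<open>For open \<open>S\<close> this is the usual class \<open>C\<^sup>k\<close> in the sense of real calculus.\<close>

fun Ck_on :: "nat \<Rightarrow> 'v::real_normed_vector set \<Rightarrow> ('v \<Rightarrow> 'w::real_normed_vector) \<Rightarrow> bool" where
  "Ck_on 0 S f \<longleftrightarrow> continuous_on S f"
| "Ck_on (Suc k) S f \<longleftrightarrow> (\<forall>x\<in>S. f differentiable (at x)) \<and>
     (\<forall>v. Ck_on k S (\<lambda>x. frechet_derivative f (at x) v))"

definition smooth_on :: "'v::real_normed_vector set \<Rightarrow> ('v \<Rightarrow> 'w::real_normed_vector) \<Rightarrow> bool" where
  "smooth_on S f \<longleftrightarrow> (\<forall>k. Ck_on k S f)"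

definition holomorphic_map_on :: "(complex^'n) set \<Rightarrow> (complex^'n \<Rightarrow> complex^'m) \<Rightarrow> bool" where
  "holomorphic_map_on S F \<longleftrightarrow>
     (\<forall>z\<in>S. \<exists>L. (F has_derivative L) (at z) \<and> (\<forall>c v. L (c *s v) = c *s L v))"

text \<open>A chart is a pair of a coordinate domain and a coordinate map; the values of the map outside
  the domain are irrelevant.\<close>

type_synonym ('a, 'n) chart = "'a set \<times> ('a \<Rightarrow> complex^'n)"

abbreviation chart_dom :: "('a, 'n) chart \<Rightarrow> 'a set" where
  "chart_dom \<equiv> fst"

abbreviation chart_map :: "('a, 'n) chart \<Rightarrow> 'a \<Rightarrow> complex^'n" where
  "chart_map \<equiv> snd"

definition chart_image :: "('a, 'n) chart \<Rightarrow> (complex^'n) set" where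
  "chart_image \<kappa> = chart_map \<kappa> ` chart_dom \<kappa>"

definition chart_inv :: "('a, 'n) chart \<Rightarrow> complex^'n \<Rightarrow> 'a" where
  "chart_inv \<kappa> = inv_into (chart_dom \<kappa>) (chart_map \<kappa>)"

definition complex_manifold :: "'a topology \<Rightarrow> ('a, 'n::finite) chart set \<Rightarrow> bool" where
  "complex_manifold X \<A> \<longleftrightarrow>
     Hausdorff_space X \<and> second_countable X \<and>
     (\<Union>\<kappa>\<in>\<A>. chart_dom \<kappa>) = topspace X \<and>
     (\<forall>\<kappa>\<in>\<A>. openin X (chart_dom \<kappa>) \<and> open (chart_image \<kappa>) \<and>
        homeomorphic_map (subtopology X (chart_dom \<kappa>)) (top_of_set (chart_image \<kappa>)) (chart_map \<kappa>)) \<and>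
     (\<forall>\<kappa>\<in>\<A>. \<forall>\<mu>\<in>\<A>. holomorphic_map_on (chart_map \<kappa> ` (chart_dom \<kappa> \<inter> chart_dom \<mu>))
        (chart_map \<mu> \<circ> chart_inv \<kappa>))"

definition smooth_function :: "('a, 'n::finite) chart set \<Rightarrow> ('a \<Rightarrow> 'w::real_normed_vector) \<Rightarrow> bool" where
  "smooth_function \<A> f \<longleftrightarrow> (\<forall>\<kappa>\<in>\<A>. smooth_on (chart_image \<kappa>) (f \<circ> chart_inv \<kappa>))"


section \<open>The exterior algebra\<close>

text \<open>
  The complexified exterior algebra of the cotangent space of \<open>\<complex>\<^sup>n\<close>. The generator \<open>Inl i\<close> is
  \<open>dz\<^sub>i\<close>, and \<open>Inr i\<close> is its conjugate. An element is given by its coefficients on the basis monomials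
  indexed by sets \<open>S\<close> of generators, the monomial of \<open>S\<close> being the wedge product of the elements of
  \<open>S\<close> in increasing order, with all \<open>Inl\<close> before all \<open>Inr\<close>. The ring multiplication is the wedge
  product, so that powers are wedge powers.
\<close>

datatype 'n cform = Form (coeff: "('n + 'n) set \<Rightarrow> complex")

lemma cform_eqI: "(\<And>S. coeff a S = coeff b S) \<Longrightarrow> a = b"
  by (cases a; cases b) auto

fun precedes :: "'n::linorder + 'n \<Rightarrow> 'n + 'n \<Rightarrow> bool" where
  "precedes (Inl i) (Inl j) \<longleftrightarrow> i < j"
| "precedes (Inl i) (Inr j) \<longleftrightarrow> True"
| "precedes (Inr i) (Inl j) \<longleftrightarrow> False"
| "precedes (Inr i) (Inr j) \<longleftrightarrow> i < j"

text \<open>For disjoint \<open>S\<close> and \<open>T\<close>, the sign of the permutation sorting the concatenation of \<open>S\<close> and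
  \<open>T\<close>.\<close>

definition wedge_sign :: "('n::linorder + 'n) set \<Rightarrow> ('n + 'n) set \<Rightarrow> complex" where
  "wedge_sign S T = (-1) ^ card {(s, t). s \<in> S \<and> t \<in> T \<and> precedes t s}"

lemma wedge_sign_Un_left:
  fixes S T R :: "('n::{finite,linorder} + 'n) set"
  assumes "S \<inter> T = {}"
  shows "wedge_sign (S \<union> T) R = wedge_sign S R * wedge_sign T R"
proof -
  have "{(s, t). s \<in> S \<union> T \<and> t \<in> R \<and> precedes t s} =
      {(s, t). s \<in> S \<and> t \<in> R \<and> precedes t s} \<union> {(s, t). s \<in> T \<and> t \<in> R \<and> precedes t s}"
    by auto
  moreover have "{(s, t). s \<in> S \<and> t \<in> R \<and> precedes t s} \<inter> {(s, t). s \<in> T \<and> t \<in> R \<and> precedes t s} = {}"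
    using assms by auto
  ultimately show ?thesis
    unfolding wedge_sign_def by (simp add: card_Un_disjoint power_add)
qed

lemma wedge_sign_Un_right:
  fixes S T R :: "('n::{finite,linorder} + 'n) set"
  assumes "S \<inter> T = {}"
  shows "wedge_sign R (S \<union> T) = wedge_sign R S * wedge_sign R T"
proof -
  have "{(s, t). s \<in> R \<and> t \<in> S \<union> T \<and> precedes t s} =
      {(s, t). s \<in> R \<and> t \<in> S \<and> precedes t s} \<union> {(s, t). s \<in> R \<and> t \<in> T \<and> precedes t s}"
    by auto
  moreover have "{(s, t). s \<in> R \<and> t \<in> S \<and> precedes t s} \<inter> {(s, t). s \<in> R \<and> t \<in> T \<and> precedes t s} = {}"
    using assms by auto
  ultimately show ?thesis
    unfolding wedge_sign_def by (simp add: card_Un_disjoint power_add)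
qed

lemma wedge_sign_empty [simp]: "wedge_sign {} S = 1" "wedge_sign S {} = 1"
  by (simp_all add: wedge_sign_def)

instantiation cform :: ("{finite,linorder}") ring_1
begin

definition zero_cform :: "'a cform" where
  "zero_cform = Form (\<lambda>S. 0)"

definition one_cform :: "'a cform" where
  "one_cform = Form (\<lambda>S. if S = {} then 1 else 0)"

definition plus_cform :: "'a cform \<Rightarrow> 'a cform \<Rightarrow> 'a cform" where
  "plus_cform a b = Form (\<lambda>S. coeff a S + coeff b S)"

definition uminus_cform :: "'a cform \<Rightarrow> 'a cform" where
  "uminus_cform a = Form (\<lambda>S. - coeff a S)"

definition minus_cform :: "'a cform \<Rightarrow> 'a cform \<Rightarrow> 'a cform" where
  "minus_cform a b = Form (\<lambda>S. coeff a S - coeff b S)"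

definition times_cform :: "'a cform \<Rightarrow> 'a cform \<Rightarrow> 'a cform" where
  "times_cform a b =
     Form (\<lambda>S. \<Sum>T\<in>Pow S. wedge_sign T (S - T) * coeff a T * coeff b (S - T))"

instance
proof
  fix a b c :: "'a cform"
  show "a + b + c = a + (b + c)" "a + b = b + a" "0 + a = a" "- a + a = 0" "a - b = a + - b"
    by (simp_all add: plus_cform_def zero_cform_def uminus_cform_def minus_cform_def add_ac)
  show "(0::'a cform) \<noteq> 1"
    by (auto simp: zero_cform_def one_cform_def fun_eq_iff)
  show "(a + b) * c = a * c + b * c" "a * (b + c) = a * b + a * c"
    by (simp_all add: plus_cform_def times_cform_def algebra_simps sum.distrib)
  show "1 * a = a"
  proof (rule cform_eqI)
    fix S
    have "coeff (1 * a) S =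
        (\<Sum>T\<in>Pow S. if T = {} then wedge_sign T (S - T) * coeff a (S - T) else 0)"
      unfolding times_cform_def one_cform_def cform.sel by (rule sum.cong) auto
    then show "coeff (1 * a) S = coeff a S" by simp
  qed
  show "a * 1 = a"
  proof (rule cform_eqI)
    fix S
    have "coeff (a * 1) S =
        (\<Sum>T\<in>Pow S. if T = S then wedge_sign T (S - T) * coeff a T else 0)"
      unfolding times_cform_def one_cform_def cform.sel by (rule sum.cong) auto
    then show "coeff (a * 1) S = coeff a S" by simp
  qed
  show "a * b * c = a * (b * c)"
  proof (rule cform_eqI)
    fix S
    have "coeff (a * b * c) S = (\<Sum>(T, R)\<in>Sigma (Pow S) Pow.
        wedge_sign T (S - T) * wedge_sign R (T - R) * coeff a R * coeff b (T - R) * coeff c (S - T))"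
      unfolding times_cform_def
      by (simp add: sum.Sigma[symmetric] sum_distrib_left sum_distrib_right mult_ac)
    also have "\<dots> = (\<Sum>(R, Q)\<in>(SIGMA R:Pow S. Pow (S - R)).
        wedge_sign R (S - R) * wedge_sign Q (S - R - Q) * coeff a R * coeff b Q * coeff c (S - R - Q))"
    proof (rule sum.reindex_bij_witness
        [where i = "\<lambda>(R, Q). (R \<union> Q, R)" and j = "\<lambda>(T, R). (R, T - R)"], goal_cases)
      case (5 x)
      obtain T R where x: "x = (T, R)" by (cases x)
      with 5 have TR: "T \<subseteq> S" "R \<subseteq> T" by auto
      have "wedge_sign T (S - T) = wedge_sign R (S - T) * wedge_sign (T - R) (S - T)"
        using wedge_sign_Un_left[of R "T - R" "S - T"] TR by (simp add: Un_absorb1)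
      moreover have "wedge_sign R (S - R) = wedge_sign R (T - R) * wedge_sign R (S - T)"
      proof -
        have "S - R = (T - R) \<union> (S - T)" using TR by auto
        then show ?thesis using wedge_sign_Un_right[of "T - R" "S - T" R] by auto
      qed
      moreover have "S - R - (T - R) = S - T" using TR by auto
      ultimately show ?case by (simp add: x)
    qed auto
    also have "\<dots> = coeff (a * (b * c)) S"
      unfolding times_cform_def
      by (simp add: sum.Sigma[symmetric] sum_distrib_left sum_distrib_right mult_ac)
    finally show "coeff (a * b * c) S = coeff (a * (b * c)) S" .
  qed
qed

end

definition scalar :: "complex \<Rightarrow> 'n cform" where
  "scalar c = Form (\<lambda>S. if S = {} then c else 0)"

definition dz :: "'n \<Rightarrow> 'n cform" where
  "dz i = Form (\<lambda>S. if S = {Inl i} then 1 else 0)"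

definition dzbar :: "'n \<Rightarrow> 'n cform" where
  "dzbar i = Form (\<lambda>S. if S = {Inr i} then 1 else 0)"

definition type_part :: "nat \<Rightarrow> nat \<Rightarrow> 'n cform \<Rightarrow> 'n cform" where
  "type_part p q a =
     Form (\<lambda>S. if card (Inl -` S) = p \<and> card (Inr -` S) = q then coeff a S else 0)"

text \<open>\<open>log (1 - a)\<close> for nilpotent \<open>a\<close>: only finitely many powers of \<open>a\<close> are nonzero.\<close>

definition log_one_minus :: "'n::{finite,linorder} cform \<Rightarrow> 'n cform" where
  "log_one_minus a = - (\<Sum>j\<in>{j. 1 \<le> j \<and> a ^ j \<noteq> 0}. scalar (1 / of_nat j) * a ^ j)"

text \<open>The Leibniz formula, with the factors multiplied in the order of the rows. It is used for
  matrices with entries of even degree, which commute; the library determinant requires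
  a commutative ring, which the whole exterior algebra is not.\<close>

definition form_det :: "'n::{finite,linorder} cform mat \<Rightarrow> 'n cform" where
  "form_det A = (\<Sum>p | p permutes {..<dim_row A}.
     of_int (sign p) * prod_list (map (\<lambda>i. A $$ (i, p i)) [0..<dim_row A]))"


section \<open>Differential forms and Chern forms\<close>

text \<open>
  A form on a manifold is given by its expressions in the charts: \<open>\<omega> \<kappa> p\<close> is the value at the
  point \<open>p\<close> of the domain of \<open>\<kappa>\<close>, written in the frame of the coordinate differentials of \<open>\<kappa>\<close>. Two
  forms on \<open>X\<close> are equal if their expressions agree in every chart at every point of its domain.
\<close>

type_synonym ('a, 'n) dform = "('a, 'n) chart \<Rightarrow> 'a \<Rightarrow> 'n cform"
type_synonym ('a, 'n) mat_dform = "('a, 'n) chart \<Rightarrow> 'a \<Rightarrow> 'n cform mat"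

definition function_form :: "('a \<Rightarrow> complex) \<Rightarrow> ('a, 'n) dform" where
  "function_form f = (\<lambda>\<kappa> p. scalar (f p))"

text \<open>The Wirtinger derivatives with respect to \<open>z\<^sub>i\<close> and its conjugate.\<close>

definition wirtinger :: "'n::finite \<Rightarrow> (complex^'n \<Rightarrow> complex) \<Rightarrow> complex^'n \<Rightarrow> complex" where
  "wirtinger i F z =
     (frechet_derivative F (at z) (axis i 1) - \<i> * frechet_derivative F (at z) (axis i \<i>)) / 2"

definition wirtinger_bar :: "'n::finite \<Rightarrow> (complex^'n \<Rightarrow> complex) \<Rightarrow> complex^'n \<Rightarrow> complex" where
  "wirtinger_bar i F z =
     (frechet_derivative F (at z) (axis i 1) + \<i> * frechet_derivative F (at z) (axis i \<i>)) / 2"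

definition del :: "('a, 'n::{finite,linorder}) dform \<Rightarrow> ('a, 'n) dform" where
  "del \<omega> = (\<lambda>\<kappa> p. \<Sum>i\<in>UNIV. dz i *
     Form (\<lambda>S. wirtinger i (\<lambda>z. coeff (\<omega> \<kappa> (chart_inv \<kappa> z)) S) (chart_map \<kappa> p)))"

definition delbar :: "('a, 'n::{finite,linorder}) dform \<Rightarrow> ('a, 'n) dform" where
  "delbar \<omega> = (\<lambda>\<kappa> p. \<Sum>i\<in>UNIV. dzbar i *
     Form (\<lambda>S. wirtinger_bar i (\<lambda>z. coeff (\<omega> \<kappa> (chart_inv \<kappa> z)) S) (chart_map \<kappa> p)))"

definition function_mat_form :: "('a \<Rightarrow> complex mat) \<Rightarrow> ('a, 'n) mat_dform" where
  "function_mat_form A = (\<lambda>\<kappa> p. map_mat scalar (A p))"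

definition del_mat :: "('a, 'n::{finite,linorder}) mat_dform \<Rightarrow> ('a, 'n) mat_dform" where
  "del_mat A = (\<lambda>\<kappa> p. Matrix.mat (dim_row (A \<kappa> p)) (dim_col (A \<kappa> p))
     (\<lambda>ij. del (\<lambda>\<mu> q. A \<mu> q $$ ij) \<kappa> p))"

definition delbar_mat :: "('a, 'n::{finite,linorder}) mat_dform \<Rightarrow> ('a, 'n) mat_dform" where
  "delbar_mat A = (\<lambda>\<kappa> p. Matrix.mat (dim_row (A \<kappa> p)) (dim_col (A \<kappa> p))
     (\<lambda>ij. delbar (\<lambda>\<mu> q. A \<mu> q $$ ij) \<kappa> p))"

text \<open>In what follows \<open>h\<close> is the matrix of a Hermitian metric on the trivial bundle \<open>X \<times> \<complex>\<^sup>r\<close> in its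
  standard frame.\<close>

definition connection_form :: "('a \<Rightarrow> complex mat) \<Rightarrow> ('a, 'n::{finite,linorder}) mat_dform" where
  "connection_form h =
     (\<lambda>\<kappa> p. map_mat scalar (the (mat_inverse (h p))) * del_mat (function_mat_form h) \<kappa> p)"

definition curvature_form :: "('a \<Rightarrow> complex mat) \<Rightarrow> ('a, 'n::{finite,linorder}) mat_dform" where
  "curvature_form h = delbar_mat (connection_form h)"

definition total_chern_form :: "('a \<Rightarrow> complex mat) \<Rightarrow> ('a, 'n::{finite,linorder}) dform" where
  "total_chern_form h = (\<lambda>\<kappa> p.
     form_det (1\<^sub>m (dim_row (h p)) + scalar (\<i> / (2 * of_real pi)) \<cdot>\<^sub>m curvature_form h \<kappa> p))"

definition chern_form :: "nat \<Rightarrow> ('a \<Rightarrow> complex mat) \<Rightarrow> ('a, 'n::{finite,linorder}) dform" where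
  "chern_form k h = (\<lambda>\<kappa> p. type_part k k (total_chern_form h \<kappa> p))"


section \<open>The metric\<close>

text \<open>Rows and columns are numbered from \<open>0\<close>, while the functions are \<open>f 1, \<dots>, f (r - 1)\<close>.\<close>

definition g_mat :: "nat \<Rightarrow> (nat \<Rightarrow> 'a \<Rightarrow> complex) \<Rightarrow> ('a \<Rightarrow> real) \<Rightarrow> 'a \<Rightarrow> complex mat" where
  "g_mat r f \<sigma> p = Matrix.mat r r (\<lambda>(i, j).
     if i = r - 1 \<and> j = r - 1 then of_real (exp (\<sigma> p / 2))
     else if i = j then 1
     else if j = r - 1 then cnj (f (i + 1) p)
     else 0)"

definition h_mat :: "nat \<Rightarrow> (nat \<Rightarrow> 'a \<Rightarrow> complex) \<Rightarrow> ('a \<Rightarrow> real) \<Rightarrow> 'a \<Rightarrow> complex mat" where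
  "h_mat r f \<sigma> p = mat_adjoint (g_mat r f \<sigma> p) * g_mat r f \<sigma> p"

definition line_metric :: "('a \<Rightarrow> real) \<Rightarrow> 'a \<Rightarrow> complex mat" where
  "line_metric \<sigma> p = Matrix.mat 1 1 (\<lambda>_. of_real (exp (\<sigma> p)))"

definition U_form ::
  "nat \<Rightarrow> (nat \<Rightarrow> 'a \<Rightarrow> complex) \<Rightarrow> ('a \<Rightarrow> real) \<Rightarrow> ('a, 'n::{finite,linorder}) dform" where
  "U_form r f \<sigma> = (\<lambda>\<kappa> p. scalar (of_real (exp (- \<sigma> p))) *
     (\<Sum>i = 1..r - 1. del (function_form (f i)) \<kappa> p *
        delbar (function_form (\<lambda>q. cnj (f i q))) \<kappa> p))"

end

theory Submission
  imports Defs
begin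

text \<open>
  Near a point let \<open>v\<^sub>i\<close> be the conjugate of \<open>f\<^sub>i\<close> and put \<open>a\<^sub>i = e\<^sup>-\<^sup>\<sigma> \<partial>f\<^sub>i\<close>, \<open>b\<^sub>i = \<partial>' v\<^sub>i\<close>,
  \<open>R\<^sub>i = \<partial>' a\<^sub>i\<close>, \<open>C\<^sub>i = \<partial>' \<partial> v\<^sub>i - b\<^sub>i \<partial>\<sigma>\<close>, where \<open>\<partial>'\<close> is the antiholomorphic derivative, so that
  \<open>U = \<Sum> a\<^sub>i b\<^sub>i\<close>. Conjugation by the unipotent matrix with last column \<open>v\<close> turns the curvature into
  the bordered matrix with corner \<open>x\<^sub>i\<^sub>j = a\<^sub>j b\<^sub>i\<close>, border \<open>C\<^sub>i\<close>, \<open>R\<^sub>j\<close> and last entry \<open>\<partial>' \<partial>\<sigma> - U\<close>. As the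
  \<open>a\<^sub>i\<close> and \<open>b\<^sub>i\<close> anticommute, with \<open>c = \<i> / 2\<pi>\<close> one gets \<open>det (1 + c x) = (1 - c U)\<^sup>-\<^sup>1\<close> and
  \<open>(1 + c x)\<^sup>-\<^sup>1 = 1 - c x / (1 - c U)\<close>, which evaluates the full determinant. The result is compared
  with \<open>\<partial>' \<partial> log (1 - c U)\<close> by means of \<open>\<partial>U = \<Sum> a\<^sub>i C\<^sub>i\<close>, \<open>\<partial>'U = \<Sum> R\<^sub>i b\<^sub>i\<close> and
  \<open>\<partial>' \<partial>U = \<Sum> R\<^sub>i C\<^sub>i - U \<partial>' \<partial>\<sigma>\<close>.
\<close>

section \<open>The exterior algebra\<close>

text \<open>For commuting factors the 2 by 2 minors of a rank one matrix vanish and det (1 + c x) =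
  1 + c tr x. Here the factors are odd, so it is the 2 by 2 permanents of x that vanish, and the
  determinant becomes the reciprocal of 1 - c tr x with tr x = U. This reciprocal and its square are
  what two derivatives of the logarithm produce. It exists because U is nilpotent: it is a geometric
  sum cut off at an exponent beyond the complex dimension.

  The odd forms do not commute, so no determinant calculus applies to them directly. The matrix
  entries, however, are even, and even forms make up a commutative ring. All that the determinants
  have to know about the odd factors is \<open>x i j * x k l = - (x i l * x k j)\<close> and
  \<open>x i j * x k j = 0\<close>, which can be stated inside that ring.

  The unipotent conjugation is not a change of holomorphic frame, since the \<open_v> entries are in
  general not holomorphic. It is therefore applied at a point, to the curvature matrix after all
  derivatives have been taken, where it is plain linear algebra.\<close>

lemma cform_coeff_zero [simp]: "coeff (0 :: 'n::{finite,linorder} cform) S = 0"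
  and cform_coeff_one: "coeff (1 :: 'n::{finite,linorder} cform) S = (if S = {} then 1 else 0)"
  and cform_coeff_add [simp]: "coeff (a + b) S = coeff a S + coeff (b :: 'n cform) S"
  and cform_coeff_diff [simp]: "coeff (a - b) S = coeff a S - coeff (b :: 'n cform) S"
  and cform_coeff_uminus [simp]: "coeff (- a) S = - coeff (a :: 'n cform) S"
  by (simp_all add: zero_cform_def one_cform_def plus_cform_def minus_cform_def uminus_cform_def)

lemma cform_coeff_times:
  "coeff (a * b) S = (\<Sum>T\<in>Pow S. wedge_sign T (S - T) * coeff a T * coeff b (S - T))"
  by (simp add: times_cform_def)

lemma cform_coeff_sum [simp]: "coeff (sum f A) S = (\<Sum>x\<in>A. coeff (f x :: 'n::{finite,linorder} cform) S)"
  by (induction A rule: infinite_finite_induct) auto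

lemma coeff_scalar: "coeff (scalar c) S = (if S = {} then c else 0)"
  by (simp add: scalar_def)

lemma coeff_scalar_mult [simp]:
  "coeff (scalar c * a) S = c * coeff (a :: 'n::{finite,linorder} cform) S"
proof -
  have "coeff (scalar c * a) S = (\<Sum>T\<in>Pow S. if T = {} then c * coeff a S else 0)"
    unfolding cform_coeff_times by (rule sum.cong) (auto simp: coeff_scalar)
  then show ?thesis by simp
qed

lemma scalar_commute: "a * scalar c = scalar c * (a :: 'n::{finite,linorder} cform)"
proof (rule cform_eqI)
  fix S
  have "coeff (a * scalar c) S = (\<Sum>T\<in>Pow S. if T = S then c * coeff a S else 0)"
    unfolding cform_coeff_times by (rule sum.cong) (auto simp: coeff_scalar)
  then show "coeff (a * scalar c) S = coeff (scalar c * a) S" by simp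
qed

lemma scalar_left_commute:
  "a * (scalar c * b) = scalar c * (a * (b :: 'n::{finite,linorder} cform))"
  by (metis mult.assoc scalar_commute)

lemma scalar_0 [simp]: "scalar 0 = (0 :: 'n::{finite,linorder} cform)"
  and scalar_1 [simp]: "scalar 1 = (1 :: 'n::{finite,linorder} cform)"
  and scalar_add: "scalar (b + c) = scalar b + (scalar c :: 'n::{finite,linorder} cform)"
  and scalar_uminus: "scalar (- b) = - (scalar b :: 'n::{finite,linorder} cform)"
  and scalar_mult: "scalar (b * c) = scalar b * (scalar c :: 'n::{finite,linorder} cform)"
  by (rule cform_eqI; simp add: coeff_scalar cform_coeff_one)+

lemma scalar_sum: "scalar (sum f A) = (\<Sum>x\<in>A. scalar (f x) :: 'n::{finite,linorder} cform)"
  by (induction A rule: infinite_finite_induct) (auto simp: scalar_add)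

lemma scalar_of_nat: "scalar (of_nat k) = (of_nat k :: 'n::{finite,linorder} cform)"
  by (induction k) (auto simp: scalar_add)

section \<open>Bidegree of forms\<close>

definition form_type :: "nat \<Rightarrow> nat \<Rightarrow> 'n cform \<Rightarrow> bool" where
  "form_type p q a \<longleftrightarrow> (\<forall>S. coeff a S \<noteq> 0 \<longrightarrow> card (Inl -` S) = p \<and> card (Inr -` S) = q)"

lemma card_vimage_Inl_Inr:
  fixes S :: "('n::finite + 'n) set"
  shows "card S = card (Inl -` S) + card (Inr -` S)"
proof -
  have "S = Inl -` S <+> Inr -` S"
    by (auto simp: Plus_def image_iff) (metis sum.exhaust)
  then show ?thesis by (metis card_Plus finite)
qed

lemma form_type_degree:
  fixes a :: "'n::finite cform"
  assumes "form_type p q a" "coeff a S \<noteq> 0"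
  shows "card S = p + q"
  using assms by (auto simp: form_type_def card_vimage_Inl_Inr)

lemma form_type_zero [simp]: "form_type p q (0 :: 'n::{finite,linorder} cform)"
  and form_type_one [simp]: "form_type 0 0 (1 :: 'n::{finite,linorder} cform)"
  and form_type_scalar [simp]: "form_type 0 0 (scalar c)"
  by (auto simp: form_type_def cform_coeff_one coeff_scalar)

lemma form_type_add: "form_type p q a \<Longrightarrow> form_type p q b \<Longrightarrow> form_type p q (a + b)"
  and form_type_diff: "form_type p q a \<Longrightarrow> form_type p q b \<Longrightarrow> form_type p q (a - b)"
  and form_type_uminus: "form_type p q a \<Longrightarrow> form_type p q (- a)"
  for a b :: "'n::{finite,linorder} cform"
  unfolding form_type_def cform_coeff_add cform_coeff_diff cform_coeff_uminus by (metis add.left_neutral diff_self minus_zero)+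

lemma form_type_sum:
  "(\<And>x. x \<in> A \<Longrightarrow> form_type p q (f x :: 'n::{finite,linorder} cform)) \<Longrightarrow> form_type p q (sum f A)"
  by (induction A rule: infinite_finite_induct) (auto simp: form_type_add)

lemma form_type_mult:
  fixes a b :: "'n::{finite,linorder} cform"
  assumes "form_type p q a" "form_type p' q' b"
  shows "form_type (p + p') (q + q') (a * b)"
  unfolding form_type_def
proof (intro allI impI)
  fix S assume "coeff (a * b) S \<noteq> 0"
  then obtain T where T: "T \<subseteq> S" "coeff a T \<noteq> 0" "coeff b (S - T) \<noteq> 0"
    unfolding cform_coeff_times by (metis (no_types, lifting) PowD mult_eq_0_iff sum.neutral)
  have *: "card (h -` S) = card (h -` T) + card (h -` (S - T))" if "inj h" for h :: "'n \<Rightarrow> 'n + 'n"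
    by (subst card_Un_disjoint[symmetric]) (use T in \<open>auto intro: arg_cong[where f = card]\<close>)
  show "card (Inl -` S) = p + p' \<and> card (Inr -` S) = q + q'"
    using T assms by (auto simp: form_type_def *)
qed

lemma form_type_scalar_mult:
  "form_type p q a \<Longrightarrow> form_type p q (scalar c * (a :: 'n::{finite,linorder} cform))"
  using form_type_mult[OF form_type_scalar] by fastforce

lemma form_type_power:
  fixes a :: "'n::{finite,linorder} cform"
  shows "form_type p q a \<Longrightarrow> form_type (k * p) (k * q) (a ^ k)"
  by (induction k) (auto intro: form_type_mult)

lemma form_type_dz: "form_type 1 0 (dz i)"
proof -
  have "Inl -` {Inl i :: 'a + 'a} = {i}" "Inr -` {Inl i :: 'a + 'a} = {}"
    by auto
  then show ?thesis
    by (simp add: form_type_def dz_def)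
qed

lemma form_type_dzbar: "form_type 0 1 (dzbar i)"
proof -
  have "Inl -` {Inr i :: 'a + 'a} = {}" "Inr -` {Inr i :: 'a + 'a} = {i}"
    by auto
  then show ?thesis
    by (simp add: form_type_def dzbar_def)
qed

text \<open>There are only \<open>CARD('n)\<close> generators \<open>Inl i\<close>. This is the
  source of all nilpotency below: powers of a form of type (1,1) vanish beyond the
  dimension.\<close>

lemma form_type_eq_zero:
  fixes a :: "'n::{finite,linorder} cform"
  assumes "form_type p q a" "p > CARD('n)"
  shows "a = 0"
proof (rule cform_eqI)
  fix S :: "('n + 'n) set"
  have "card (Inl -` S) \<le> CARD('n)" by (simp add: card_mono)
  then show "coeff a S = coeff 0 S" using assms by (force simp: form_type_def)
qed

lemma type_part_eq:
  fixes a :: "'n::{finite,linorder} cform"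
  assumes "form_type p q a"
  shows "type_part p' q' a = (if p = p' \<and> q = q' then a else 0)"
  by (rule cform_eqI) (use assms in \<open>auto simp: type_part_def form_type_def\<close>)

lemma type_part_add: "type_part p q (a + b) = type_part p q a + (type_part p q b :: 'n::{finite,linorder} cform)"
  by (rule cform_eqI) (auto simp: type_part_def)

lemma type_part_sum:
  "type_part p q (sum f A) = (\<Sum>x\<in>A. type_part p q (f x :: 'n::{finite,linorder} cform))"
  by (rule cform_eqI) (auto simp: type_part_def)

section \<open>Graded commutativity of the wedge product\<close>

lemma precedes_linear: "s \<noteq> t \<Longrightarrow> precedes s t \<longleftrightarrow> \<not> precedes t s"
  by (cases s; cases t) auto

text \<open>Each pair in \<open>S \<times> T\<close> is an inversion in exactly one of the two
  concatenations, so the two inversion counts add up to \<open>card S * card T\<close>.\<close>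

lemma wedge_sign_swap:
  fixes S T :: "('n::{finite,linorder} + 'n) set"
  assumes "S \<inter> T = {}"
  shows "wedge_sign T S = (-1) ^ (card S * card T) * wedge_sign S T"
proof -
  let ?A = "{(s, t). s \<in> S \<and> t \<in> T \<and> precedes t s}"
  let ?B = "{(s, t). s \<in> S \<and> t \<in> T \<and> precedes s t}"
  have "{(s, t). s \<in> T \<and> t \<in> S \<and> precedes t s} = prod.swap ` ?B"
    by force
  then have B: "card {(s, t). s \<in> T \<and> t \<in> S \<and> precedes t s} = card ?B"
    by (simp add: card_image)
  have *: "precedes s t \<longleftrightarrow> \<not> precedes t s" if "s \<in> S" "t \<in> T" for s t
    using precedes_linear[of s t] assms that by blast
  then have "?A \<union> ?B = S \<times> T" "?A \<inter> ?B = {}"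
    by blast+
  then have "card S * card T = card ?A + card ?B"
    using card_Un_disjoint[of ?A ?B] by (simp add: card_cartesian_product)
  then have "(-1) ^ (card S * card T) * (-1) ^ card ?A = ((-1) ^ card ?B :: complex)"
    by (simp add: power_add flip: power_mult_distrib)
  then show ?thesis
    unfolding wedge_sign_def B by simp
qed

text \<open>Passing to complements \<open>T \<mapsto> S - T\<close> exchanges the factors in each
  coefficient. The common sign \<open>e\<close> is a parameter, so that even forms
  (\<open>e = 1\<close>) and pairs of odd forms (\<open>e = -1\<close>) are treated
  together.\<close>

lemma wedge_commute:
  fixes a b :: "'n::{finite,linorder} cform"
  assumes "\<And>S T. coeff a S \<noteq> 0 \<Longrightarrow> coeff b T \<noteq> 0 \<Longrightarrow> (-1) ^ (card S * card T) = (e :: complex)"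
  shows "b * a = scalar e * (a * b)"
proof (rule cform_eqI)
  fix S
  have "coeff (b * a) S = (\<Sum>T\<in>Pow S. wedge_sign (S - T) T * coeff b (S - T) * coeff a T)"
    unfolding cform_coeff_times
    by (rule sum.reindex_bij_witness[where i = "\<lambda>T. S - T" and j = "\<lambda>T. S - T"])
       (auto simp: double_diff)
  also have "\<dots> = (\<Sum>T\<in>Pow S. e * (wedge_sign T (S - T) * coeff a T * coeff b (S - T)))"
  proof (rule sum.cong)
    fix T assume "T \<in> Pow S"
    have "wedge_sign (S - T) T = (-1) ^ (card T * card (S - T)) * wedge_sign T (S - T)"
      by (rule wedge_sign_swap) auto
    then show "wedge_sign (S - T) T * coeff b (S - T) * coeff a T =
        e * (wedge_sign T (S - T) * coeff a T * coeff b (S - T))"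
      using assms[of T "S - T"] by auto
  qed simp
  also have "\<dots> = coeff (scalar e * (a * b)) S"
    by (simp add: cform_coeff_times[of a b] sum_distrib_left)
  finally show "coeff (b * a) S = coeff (scalar e * (a * b)) S" .
qed

lemma form_type_commute:
  fixes a b :: "'n::{finite,linorder} cform"
  assumes "form_type p q a" "form_type p' q' b"
  shows "b * a = scalar ((-1) ^ ((p + q) * (p' + q'))) * (a * b)"
  by (rule wedge_commute) (simp add: form_type_degree[OF assms(1)] form_type_degree[OF assms(2)])

lemma form_type_anticommute:
  fixes a b :: "'n::{finite,linorder} cform"
  assumes "form_type p q a" "form_type p' q' b" "odd (p + q)" "odd (p' + q')"
  shows "b * a = - (a * b)"
  using form_type_commute[OF assms(1,2)] assms(3,4) by (simp add: scalar_uminus)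

section \<open>The commutative ring of even forms\<close>

definition even_form :: "'n cform \<Rightarrow> bool" where
  "even_form a \<longleftrightarrow> (\<forall>S. coeff a S \<noteq> 0 \<longrightarrow> even (card S))"

lemma form_type_even_form:
  fixes a :: "'n::finite cform"
  shows "form_type p q a \<Longrightarrow> even (p + q) \<Longrightarrow> even_form a"
  by (auto simp: even_form_def form_type_degree)

lemma even_form_commute:
  fixes a b :: "'n::{finite,linorder} cform"
  assumes "even_form a"
  shows "b * a = a * b"
  using wedge_commute[of a b 1] assms by (auto simp: even_form_def)

lemma even_form_zero: "even_form (0 :: 'n::{finite,linorder} cform)"
  and even_form_one: "even_form (1 :: 'n::{finite,linorder} cform)"
  by (auto simp: even_form_def cform_coeff_one)

lemma even_form_add: "even_form a \<Longrightarrow> even_form b \<Longrightarrow> even_form (a + b)"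
  and even_form_diff: "even_form a \<Longrightarrow> even_form b \<Longrightarrow> even_form (a - b)"
  and even_form_uminus: "even_form a \<Longrightarrow> even_form (- a)"
  for a b :: "'n::{finite,linorder} cform"
  unfolding even_form_def cform_coeff_add cform_coeff_diff cform_coeff_uminus by (metis add.left_neutral diff_self minus_zero)+

lemma even_form_mult:
  fixes a b :: "'n::{finite,linorder} cform"
  assumes "even_form a" "even_form b"
  shows "even_form (a * b)"
  unfolding even_form_def
proof (intro allI impI)
  fix S assume "coeff (a * b) S \<noteq> 0"
  then obtain T where T: "T \<subseteq> S" "coeff a T \<noteq> 0" "coeff b (S - T) \<noteq> 0"
    unfolding cform_coeff_times by (metis (no_types, lifting) PowD mult_eq_0_iff sum.neutral)
  then have "card S = card T + card (S - T)"
    by (metis card_Diff_subset card_mono finite le_add_diff_inverse)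
  then show "even (card S)"
    using T assms by (auto simp: even_form_def)
qed

lemma even_form_power: "even_form a \<Longrightarrow> even_form (a ^ k)" for a :: "'n::{finite,linorder} cform"
  by (induction k) (auto intro: even_form_one even_form_mult)

lemma even_form_sum:
  "(\<And>x. x \<in> A \<Longrightarrow> even_form (f x :: 'n::{finite,linorder} cform)) \<Longrightarrow> even_form (sum f A)"
  by (induction A rule: infinite_finite_induct) (auto intro: even_form_zero even_form_add)

text \<open>Evenness rather than a fixed bidegree is required here: entries such as 1 plus a
  multiple of a curvature form mix degrees. As a type, the even forms become an instance of
  \<open>comm_ring_1\<close>, over which the usual rules for determinants hold.\<close>

typedef (overloaded) 'n even_cform = "{a :: 'n::{finite,linorder} cform. even_form a}"
  by (auto intro: even_form_zero)

setup_lifting type_definition_even_cform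

instantiation even_cform :: ("{finite,linorder}") comm_ring_1
begin

lift_definition zero_even_cform :: "'a even_cform" is 0 by (rule even_form_zero)
lift_definition one_even_cform :: "'a even_cform" is 1 by (rule even_form_one)
lift_definition plus_even_cform :: "'a even_cform \<Rightarrow> 'a even_cform \<Rightarrow> 'a even_cform" is "(+)"
  by (rule even_form_add)
lift_definition uminus_even_cform :: "'a even_cform \<Rightarrow> 'a even_cform" is uminus
  by (rule even_form_uminus)
lift_definition minus_even_cform :: "'a even_cform \<Rightarrow> 'a even_cform \<Rightarrow> 'a even_cform" is "(-)"
  by (rule even_form_diff)
lift_definition times_even_cform :: "'a even_cform \<Rightarrow> 'a even_cform \<Rightarrow> 'a even_cform" is "(*)"
  by (rule even_form_mult)

instance
  by standard (transfer; simp add: algebra_simps even_form_commute)+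

end

lemma Rep_even_cform_sum: "Rep_even_cform (sum f A) = (\<Sum>x\<in>A. Rep_even_cform (f x))"
  by (induction A rule: infinite_finite_induct) (auto simp: zero_even_cform.rep_eq plus_even_cform.rep_eq)

lemma Rep_even_cform_of_int: "Rep_even_cform (of_int k) = of_int k"
proof -
  have "Rep_even_cform (of_nat k) = of_nat k" for k
    by (induction k) (auto simp: zero_even_cform.rep_eq one_even_cform.rep_eq plus_even_cform.rep_eq)
  then show ?thesis
    by (cases k) (auto simp: uminus_even_cform.rep_eq minus_even_cform.rep_eq one_even_cform.rep_eq)
qed

lemma Rep_even_cform_prod_list:
  "Rep_even_cform (prod_list xs) = prod_list (map Rep_even_cform xs)"
  by (induction xs) (auto simp: one_even_cform.rep_eq times_even_cform.rep_eq)

text \<open>Both sides are Leibniz sums. In the commutative ring the product over the set of rows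
  equals the product along the list of rows, which is the order that \<open>form_det\<close>
  prescribes.\<close>

lemma form_det_even:
  assumes "B \<in> carrier_mat n n"
  shows "form_det (map_mat Rep_even_cform B) = Rep_even_cform (Determinant.det B)"
proof -
  have "prod_list (map (\<lambda>i. map_mat Rep_even_cform B $$ (i, p i)) [0..<n]) =
      Rep_even_cform (\<Prod>i = 0..<n. B $$ (i, p i))" if "p permutes {..<n}" for p
  proof -
    have "p i < n" if "i < n" for i
      using \<open>p permutes {..<n}\<close> that permutes_in_image by fastforce
    then have "map (\<lambda>i. map_mat Rep_even_cform B $$ (i, p i)) [0..<n] =
        map Rep_even_cform (map (\<lambda>i. B $$ (i, p i)) [0..<n])"
      using assms by auto
    also have "prod_list \<dots> = Rep_even_cform (prod_list (map (\<lambda>i. B $$ (i, p i)) [0..<n]))"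
      by (simp add: Rep_even_cform_prod_list)
    also have "prod_list (map (\<lambda>i. B $$ (i, p i)) [0..<n]) = (\<Prod>i = 0..<n. B $$ (i, p i))"
      by (metis atLeastLessThan_upt distinct_upt prod.distinct_set_conv_list)
    finally show ?thesis .
  qed
  then show ?thesis
    using assms unfolding form_det_def det_def'[OF assms]
    by (simp add: Rep_even_cform_sum times_even_cform.rep_eq Rep_even_cform_of_int atLeast0LessThan)
qed

section \<open>Determinants of bordered matrices\<close>

text \<open>Multiplication by this matrix on the left adds multiples of the last row to the others;
  on the right it adds a combination of the other columns to the last. It serves both operations
  below.\<close>

lemma det_elementary:
  fixes u :: "nat \<Rightarrow> 'a::comm_ring_1"
  shows "Determinant.det (Matrix.mat (Suc n) (Suc n)
    (\<lambda>(i, j). if i = j then 1 else if j = n then u i else 0)) = 1" (is "Determinant.det ?E = 1")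
proof -
  have "Determinant.det ?E = prod_list (diag_mat ?E)"
    by (rule det_upper_triangular[where n = "Suc n"]) auto
  also have "diag_mat ?E = replicate (Suc n) 1"
    by (rule nth_equalityI) (auto simp: diag_mat_def simp del: upt_Suc replicate_Suc)
  finally show ?thesis by simp
qed

lemma det_add_last_row:
  fixes B :: "nat \<Rightarrow> nat \<Rightarrow> 'a::comm_ring_1"
  shows "Determinant.det (Matrix.mat (Suc n) (Suc n)
      (\<lambda>(i, j). if i < n then B i j + u i * B n j else B n j)) =
    Determinant.det (Matrix.mat (Suc n) (Suc n) (\<lambda>(i, j). B i j))"
    (is "Determinant.det ?B' = Determinant.det ?B")
proof -
  let ?E = "Matrix.mat (Suc n) (Suc n) (\<lambda>(i, j). if i = j then 1 else if j = n then u i else 0)"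
  have "?B' = ?E * ?B"
  proof (rule eq_matI)
    fix i j assume "i < dim_row (?E * ?B)" "j < dim_col (?E * ?B)"
    then have ij: "i < Suc n" "j < Suc n" by auto
    have "(\<Sum>k = 0..<n. (if i = k then 1 else if k = n then u i else 0) * B k j) =
        (\<Sum>k = 0..<n. if i = k then B i j else 0)"
      by (rule sum.cong) auto
    then show "?B' $$ (i, j) = (?E * ?B) $$ (i, j)"
      using ij by (auto simp: scalar_prod_def less_Suc_eq)
  qed auto
  then show ?thesis
    using det_mult[of ?E "Suc n" ?B] by (simp add: det_elementary)
qed

lemma det_add_to_last_col:
  fixes B :: "nat \<Rightarrow> nat \<Rightarrow> 'a::comm_ring_1"
  shows "Determinant.det (Matrix.mat (Suc n) (Suc n)
      (\<lambda>(i, j). if j < n then B i j else B i n + (\<Sum>k<n. B i k * u k))) =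
    Determinant.det (Matrix.mat (Suc n) (Suc n) (\<lambda>(i, j). B i j))"
    (is "Determinant.det ?B' = Determinant.det ?B")
proof -
  let ?E = "Matrix.mat (Suc n) (Suc n) (\<lambda>(i, j). if i = j then 1 else if j = n then u i else 0)"
  have "?B' = ?B * ?E"
  proof (rule eq_matI)
    fix i j assume "i < dim_row (?B * ?E)" "j < dim_col (?B * ?E)"
    then have ij: "i < Suc n" "j < Suc n" by auto
    have "(\<Sum>k = 0..<Suc n. B i k * (if k = j then 1 else if j = n then u k else 0)) =
        (if j < n then B i j else B i n + (\<Sum>k<n. B i k * u k))"
    proof (cases "j < n")
      case True
      then have "(\<Sum>k = 0..<Suc n. B i k * (if k = j then 1 else if j = n then u k else 0)) =
          (\<Sum>k = 0..<Suc n. if k = j then B i j else 0)"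
        by (intro sum.cong) auto
      then show ?thesis using True by simp
    next
      case False
      then have "(\<Sum>k = 0..<n. B i k * (if k = j then 1 else if j = n then u k else 0)) =
          (\<Sum>k<n. B i k * u k)"
        using ij by (intro sum.cong) auto
      then show ?thesis using False ij by (simp add: less_Suc_eq)
    qed
    then show "?B' $$ (i, j) = (?B * ?E) $$ (i, j)"
      using ij by (simp add: scalar_prod_def)
  qed auto
  then show ?thesis
    using det_mult[of ?B "Suc n" ?E] by (simp add: det_elementary)
qed

lemma det_last_col_zero:
  fixes B :: "nat \<Rightarrow> nat \<Rightarrow> 'a::comm_ring_1"
  assumes "\<And>i. i < n \<Longrightarrow> B i n = 0"
  shows "Determinant.det (Matrix.mat (Suc n) (Suc n) (\<lambda>(i, j). B i j)) =
    Determinant.det (Matrix.mat n n (\<lambda>(i, j). B i j)) * B n n"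
proof -
  let ?A1 = "Matrix.mat n n (\<lambda>(i, j). B i j)" and ?A3 = "Matrix.mat 1 n (\<lambda>(i, j). B n j)"
    and ?A4 = "Matrix.mat 1 1 (\<lambda>_. B n n)"
  have "Matrix.mat (Suc n) (Suc n) (\<lambda>(i, j). B i j) = four_block_mat ?A1 (0\<^sub>m n 1) ?A3 ?A4"
    by (rule eq_matI) (use assms in \<open>auto simp: less_Suc_eq\<close>)
  also have "Determinant.det \<dots> = Determinant.det ?A1 * Determinant.det ?A4"
    by (rule det_four_block_mat_upper_right_zero_col) auto
  also have "Determinant.det ?A4 = B n n"
    by (simp add: det_single)
  finally show ?thesis .
qed

text \<open>A family \<open>x i j = \<alpha>\<^sub>j * \<beta>\<^sub>i\<close> of products of odd elements satisfies the two hypotheses.\<close>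

lemma det_one_plus_antisymmetric:
  fixes x :: "nat \<Rightarrow> nat \<Rightarrow> 'a::comm_ring_1"
  assumes "\<And>i j k l. x i j * x k l = - (x i l * x k j)" "\<And>i j k. x i j * x k j = 0"
  shows "Determinant.det (Matrix.mat n n (\<lambda>(i, j). (if i = j then 1 else 0) + x i j)) *
    (1 - (\<Sum>i<n. x i i)) = 1"
  using assms
proof (induction n arbitrary: x)
  case 0
  show ?case by simp
next
  case (Suc n)
  let ?p = "1 + x n n"
  \<comment> \<open>The pivot \<open>?p\<close> has inverse \<open>1 - x n n\<close>, because
    \<open>x n n\<close> squares to 0. Clearing the last column adds
    \<open>- (x i n * (1 - x n n)) * x n j\<close> to entry (i, j); by the hypotheses this is
    \<open>x i j * x n n\<close>. So the remaining block is again of the form 1 + y, with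
    \<open>y\<close> subject to the same hypotheses.\<close>
  define y where "y i j = x i j * ?p" for i j
  have anti: "y i j * y k l = - (y i l * y k j)" for i j k l
  proof -
    have "y i j * y k l = x i j * x k l * (?p * ?p)" "y i l * y k j = x i l * x k j * (?p * ?p)"
      unfolding y_def by (simp_all only: mult_ac)
    then show ?thesis using Suc.prems(1)[of i j k l] by simp
  qed
  have zero: "y i j * y k j = 0" for i j k
  proof -
    have "y i j * y k j = x i j * x k j * (?p * ?p)" unfolding y_def by (simp only: mult_ac)
    then show ?thesis using Suc.prems(2)[of i j k] by simp
  qed
  let ?B = "\<lambda>i j. (if i = j then 1 else 0) + x i j"
  let ?u = "\<lambda>i. - (x i n * (1 - x n n))"
  have inv: "(1 - x n n) * ?p = 1"
    using Suc.prems(2)[of n n n] by (simp add: algebra_simps)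
  have red: "?B i j + ?u i * ?B n j = (if i = j then 1 else 0) + y i j" if "i < n" "j < n" for i j
  proof -
    have "x i n * x n n * x n j = 0"
      using Suc.prems(2)[of i n n] by (simp add: mult_ac)
    then show ?thesis
      using that Suc.prems(1)[of i n n j] by (simp add: y_def algebra_simps)
  qed
  have "Determinant.det (Matrix.mat (Suc n) (Suc n) (\<lambda>(i, j). ?B i j)) =
      Determinant.det (Matrix.mat (Suc n) (Suc n) (\<lambda>(i, j). if i < n then ?B i j + ?u i * ?B n j else ?B n j))"
    by (rule det_add_last_row[symmetric])
  also have "\<dots> = Determinant.det (Matrix.mat n n (\<lambda>(i, j). if i < n then ?B i j + ?u i * ?B n j else ?B n j)) * ?p"
    by (subst det_last_col_zero) (use inv in \<open>auto simp: algebra_simps\<close>)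
  also have "Matrix.mat n n (\<lambda>(i, j). if i < n then ?B i j + ?u i * ?B n j else ?B n j) =
      Matrix.mat n n (\<lambda>(i, j). (if i = j then 1 else 0) + y i j)"
    by (rule eq_matI) (use red in auto)
  finally have det: "Determinant.det (Matrix.mat (Suc n) (Suc n) (\<lambda>(i, j). ?B i j)) =
      Determinant.det (Matrix.mat n n (\<lambda>(i, j). (if i = j then 1 else 0) + y i j)) * ?p" .
  \<comment> \<open>The pivot cancels \<open>1 - x n n\<close> and turns each remaining
    \<open>x i i\<close> into \<open>y i i\<close>, so the factor splits off just as it does from
    the determinant.\<close>
  have "?p * (1 - (\<Sum>i<Suc n. x i i)) = 1 - (\<Sum>i<n. y i i)"
    using inv by (simp add: y_def algebra_simps flip: sum_distrib_left sum_distrib_right)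
  then show ?case
    unfolding det mult.assoc using Suc.IH[of y, OF anti zero] by simp
qed

text \<open>The hypotheses on \<open>B\<close> describe P^-1 M P, where M has blocks 1 + x, C, R, e
  and P is unipotent with last column V. The isolated \<open>V i\<close> in the last column
  compensates for the 1 contained in \<open>B n n\<close>. The value is the determinant of the block
  1 + x, which is \<open>q\<close>, times its Schur complement.\<close>

lemma det_bordered_antisymmetric:
  fixes x B :: "nat \<Rightarrow> nat \<Rightarrow> 'a::comm_ring_1"
  assumes x: "\<And>i j k l. x i j * x k l = - (x i l * x k j)" "\<And>i j k. x i j * x k j = 0"
    and B: "\<And>i j. i < n \<Longrightarrow> j < n \<Longrightarrow> B i j = (if i = j then 1 else 0) + x i j - V i * R j"
    "\<And>i. i < n \<Longrightarrow> B i n = V i + (\<Sum>j<n. x i j * V j) + C i - V i * B n n"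
    "\<And>j. j < n \<Longrightarrow> B n j = R j" "B n n = e + (\<Sum>j<n. R j * V j)"
    and q: "q * (1 - (\<Sum>i<n. x i i)) = 1"
  shows "Determinant.det (Matrix.mat (Suc n) (Suc n) (\<lambda>(i, j). B i j)) =
    q * (e - (\<Sum>i<n. R i * C i) + q * (\<Sum>i<n. \<Sum>j<n. R i * x i j * C j))"
proof -
  let ?d = "\<lambda>i j. if i = j then 1 else 0 :: 'a"
  define tr where "tr = (\<Sum>i<n. x i i)"
  \<comment> \<open>The solution of (1 + x) w = C, found by taking 1 - q x as the inverse of 1 + x;
    \<open>Mw\<close> verifies it.\<close>
  define w where "w i = C i - q * (\<Sum>j<n. x i j * C j)" for i
  let ?B1 = "\<lambda>i j. if i < n then B i j + V i * B n j else B n j"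
  \<comment> \<open>One column operation does two jobs: the coefficients \<open>- V k\<close>
    complete the conjugation, and \<open>- w k\<close> then clear the last column above the
    corner.\<close>
  let ?B2 = "\<lambda>i j. if j < n then ?B1 i j else ?B1 i n + (\<Sum>k<n. ?B1 i k * (- V k - w k))"
  \<comment> \<open>Thus x squared is - tr x times x, and (1 + x)(1 - q x) = 1 + (1 - q + q tr x) x,
    where the bracket vanishes by the choice of \<open>q\<close>.\<close>
  have sq: "(\<Sum>k<n. x i k * x k j) = - (tr * x i j)" for i j
  proof -
    have "(\<Sum>k<n. x i k * x k j) = (\<Sum>k<n. - (x k k * x i j))"
      by (rule sum.cong) (use x(1)[of i _ _ j] in \<open>auto simp: mult.commute\<close>)
    then show ?thesis by (simp add: tr_def sum_distrib_right sum_negf)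
  qed
  have B1: "?B1 i j = ?d i j + x i j" if "i < n" "j < n" for i j
    using that by (simp add: B(1,3))
  have B1n: "?B1 i n = V i + (\<Sum>j<n. x i j * V j) + C i" if "i < n" for i
    using that by (simp add: B(2))
  have Mw: "w i + (\<Sum>k<n. x i k * w k) = C i" for i
  proof -
    have "(\<Sum>k<n. x i k * (\<Sum>j<n. x k j * C j)) = (\<Sum>j<n. (\<Sum>k<n. x i k * x k j) * C j)"
      by (simp add: sum_distrib_left sum_distrib_right mult.assoc) (rule sum.swap)
    also have "\<dots> = - (tr * (\<Sum>j<n. x i j * C j))"
      by (simp add: sq sum_distrib_left mult.assoc sum_negf)
    finally have "(\<Sum>k<n. x i k * w k) = (\<Sum>k<n. x i k * C k) + q * tr * (\<Sum>k<n. x i k * C k)"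
      by (simp add: w_def right_diff_distrib sum_subtractf mult.left_commute[of _ q] flip: sum_distrib_left)
    then have "w i + (\<Sum>k<n. x i k * w k) = C i + (1 + q * tr - q) * (\<Sum>k<n. x i k * C k)"
      by (simp add: w_def algebra_simps)
    also have "1 + q * tr - q = 0" using q by (simp add: tr_def algebra_simps)
    finally show ?thesis by simp
  qed
  have zero: "?B2 i n = 0" if "i < n" for i
  proof -
    have "(\<Sum>k<n. ?B1 i k * (- V k - w k)) = (\<Sum>k<n. - (?d i k * (V k + w k)) - x i k * V k - x i k * w k)"
      by (rule sum.cong) (use that B1 in \<open>auto simp: algebra_simps\<close>)
    also have "\<dots> = (\<Sum>k<n. if i = k then - (V i + w i) else 0) - (\<Sum>k<n. x i k * V k) - (\<Sum>k<n. x i k * w k)"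
      unfolding sum_subtractf by (intro arg_cong2[where f = minus] sum.cong) auto
    also have "\<dots> = - (V i + w i) - (\<Sum>k<n. x i k * V k) - (\<Sum>k<n. x i k * w k)"
      using that by simp
    finally have sum: "(\<Sum>k<n. ?B1 i k * (- V k - w k)) =
        - (V i + w i) - (\<Sum>k<n. x i k * V k) - (\<Sum>k<n. x i k * w k)" .
    have "?B2 i n = ?B1 i n + (\<Sum>k<n. ?B1 i k * (- V k - w k))" by simp
    also have "\<dots> = 0"
      unfolding sum B1n[OF that] by (simp flip: Mw[of i])
    finally show ?thesis .
  qed
  have "?B2 n n = B n n + (\<Sum>k<n. R k * (- V k - w k))"
    by (auto simp: B(3) intro!: sum.cong)
  also have "\<dots> = e - (\<Sum>k<n. R k * w k)"
    by (simp add: B(4) algebra_simps sum_subtractf sum_negf sum.distrib)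
  also have "(\<Sum>k<n. R k * w k) = (\<Sum>k<n. R k * C k) - q * (\<Sum>k<n. \<Sum>j<n. R k * x k j * C j)"
    by (simp add: w_def right_diff_distrib sum_subtractf mult.left_commute[of _ q] sum_distrib_left mult.assoc)
  finally have last: "?B2 n n = e - (\<Sum>k<n. R k * C k) + q * (\<Sum>k<n. \<Sum>j<n. R k * x k j * C j)"
    by simp
  have "Determinant.det (Matrix.mat (Suc n) (Suc n) (\<lambda>(i, j). B i j)) =
      Determinant.det (Matrix.mat (Suc n) (Suc n) (\<lambda>(i, j). ?B1 i j))"
    by (rule det_add_last_row[symmetric])
  also have "\<dots> = Determinant.det (Matrix.mat (Suc n) (Suc n) (\<lambda>(i, j). ?B2 i j))"
    by (rule det_add_to_last_col[symmetric])
  also have "\<dots> = Determinant.det (Matrix.mat n n (\<lambda>(i, j). ?B2 i j)) * ?B2 n n"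
    by (rule det_last_col_zero) (rule zero)
  also have "Matrix.mat n n (\<lambda>(i, j). ?B2 i j) = Matrix.mat n n (\<lambda>(i, j). ?d i j + x i j)"
    by (rule eq_matI) (simp_all add: B(1,3))
  \<comment> \<open>Both sides are reciprocals of \<open>1 - tr\<close>, and reciprocals in a
    commutative ring are unique.\<close>
  also have "Determinant.det \<dots> = q"
  proof -
    let ?M = "Matrix.mat n n (\<lambda>(i, j). ?d i j + x i j)"
    have "Determinant.det ?M * (1 - tr) = 1"
      unfolding tr_def by (rule det_one_plus_antisymmetric) (rule x)+
    moreover have "Determinant.det ?M * (q * (1 - tr)) = q * (Determinant.det ?M * (1 - tr))"
      by (rule mult.left_commute)
    ultimately show ?thesis
      using q by (simp only: tr_def mult_1_right)
  qed
  finally show ?thesis unfolding last .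
qed

section \<open>Smooth functions\<close>

text \<open>The two functions have the same derivatives at \<open>x\<close>, so the choice made by
  \<open>frechet_derivative\<close> is the same, even where no derivative exists.\<close>

lemma frechet_derivative_cong_open:
  assumes "open S" "x \<in> S" "\<And>y. y \<in> S \<Longrightarrow> f y = g y"
  shows "frechet_derivative f (at x) = frechet_derivative g (at x)"
proof -
  have "(f has_derivative f') (at x) \<longleftrightarrow> (g has_derivative f') (at x)" for f'
    using has_derivative_transform_within_open[of f f' x UNIV S g]
      has_derivative_transform_within_open[of g f' x UNIV S f] assms by auto
  then show ?thesis by (simp add: frechet_derivative_def)
qed

lemma frechet_derivative_eq:
  "(f has_derivative f') (at x) \<Longrightarrow> frechet_derivative f (at x) = f'"
  by (metis frechet_derivative_at)

lemma Ck_on_cong: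
  assumes "open S" "\<And>x. x \<in> S \<Longrightarrow> f x = g x"
  shows "Ck_on k S f \<longleftrightarrow> Ck_on k S g"
  using assms(2)
proof (induction k arbitrary: f g)
  case 0
  then show ?case by (simp cong: continuous_on_cong)
next
  case (Suc k)
  have "f differentiable (at x) \<longleftrightarrow> g differentiable (at x)" if "x \<in> S" for x
    using has_derivative_transform_within_open[of f _ x UNIV S g]
      has_derivative_transform_within_open[of g _ x UNIV S f] Suc.prems \<open>open S\<close> that
    unfolding differentiable_def by metis
  moreover have "Ck_on k S (\<lambda>x. frechet_derivative f (at x) v) \<longleftrightarrow>
      Ck_on k S (\<lambda>x. frechet_derivative g (at x) v)" for v
    by (rule Suc.IH) (metis frechet_derivative_cong_open Suc.prems \<open>open S\<close>)
  ultimately show ?case by simp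
qed

lemma Ck_on_SucD: "Ck_on (Suc k) S f \<Longrightarrow> Ck_on k S f"
proof (induction k arbitrary: f)
  case 0
  then show ?case
    by (auto intro!: continuous_at_imp_continuous_on differentiable_imp_continuous_within)
next
  case (Suc k)
  then show ?case by (metis Ck_on.simps(2))
qed

lemma Ck_on_const: "Ck_on k S (\<lambda>x. c)"
  by (induction k arbitrary: c) auto

lemma Ck_on_add:
  assumes "open S" "Ck_on k S f" "Ck_on k S g"
  shows "Ck_on k S (\<lambda>x. f x + g x)"
  using assms(2,3)
proof (induction k arbitrary: f g)
  case 0
  then show ?case by (auto intro: continuous_on_add)
next
  case (Suc k)
  have "frechet_derivative (\<lambda>x. f x + g x) (at x) v =
      frechet_derivative f (at x) v + frechet_derivative g (at x) v" if "x \<in> S" for x v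
    using Suc.prems that
    by (subst frechet_derivative_eq[OF has_derivative_add]) (auto simp: frechet_derivative_works)
  then have "Ck_on k S (\<lambda>x. frechet_derivative (\<lambda>x. f x + g x) (at x) v)" for v
    by (subst Ck_on_cong[OF \<open>open S\<close>]) (use Suc in auto)
  then show ?case using Suc.prems by auto
qed

lemma Ck_on_bounded_linear:
  assumes "open S" "bounded_linear L" "Ck_on k S f"
  shows "Ck_on k S (\<lambda>x. L (f x))"
  using assms(3)
proof (induction k arbitrary: f)
  case 0
  then show ?case using bounded_linear.continuous_on[OF assms(2)] by auto
next
  case (Suc k)
  have D: "((\<lambda>x. L (f x)) has_derivative (\<lambda>v. L (frechet_derivative f (at x) v))) (at x)" if "x \<in> S" for x
    using Suc.prems that
    by (intro bounded_linear.has_derivative[OF assms(2)]) (auto simp: frechet_derivative_works)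
  then have "Ck_on k S (\<lambda>x. frechet_derivative (\<lambda>x. L (f x)) (at x) v)" for v
    by (subst Ck_on_cong[OF \<open>open S\<close>, where g = "\<lambda>x. L (frechet_derivative f (at x) v)"])
       (use Suc frechet_derivative_eq[OF D] in auto)
  then show ?case using D by (auto simp: differentiable_def)
qed

lemma Ck_on_mult:
  fixes f g :: "'v::real_normed_vector \<Rightarrow> 'w::real_normed_algebra"
  assumes "open S" "Ck_on k S f" "Ck_on k S g"
  shows "Ck_on k S (\<lambda>x. f x * g x)"
  using assms(2,3)
proof (induction k arbitrary: f g)
  case 0
  then show ?case by (auto intro: continuous_on_mult)
next
  case (Suc k)
  have D: "((\<lambda>x. f x * g x) has_derivative
      (\<lambda>v. f x * frechet_derivative g (at x) v + frechet_derivative f (at x) v * g x)) (at x)"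
    if "x \<in> S" for x
    using Suc.prems that by (intro has_derivative_mult) (auto simp: frechet_derivative_works)
  have "Ck_on k S f" "Ck_on k S g"
    using Suc.prems Ck_on_SucD by blast+
  then have "Ck_on k S (\<lambda>x. f x * frechet_derivative g (at x) v + frechet_derivative f (at x) v * g x)" for v
    using Suc by (intro Ck_on_add[OF \<open>open S\<close>] Suc.IH) auto
  then have "Ck_on k S (\<lambda>x. frechet_derivative (\<lambda>x. f x * g x) (at x) v)" for v
    by (subst Ck_on_cong[OF \<open>open S\<close>]) (use frechet_derivative_eq[OF D] in auto)
  then show ?case using D by (auto simp: differentiable_def)
qed

text \<open>The derivative contains \<open>exp (f x)\<close> itself, so the induction runs over
  \<open>k\<close> with \<open>f\<close> fixed and feeds the hypothesis back through
  \<open>Ck_on_mult\<close>.\<close>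

lemma Ck_on_exp:
  fixes f :: "'v::real_normed_vector \<Rightarrow> 'w::{real_normed_field,banach}"
  assumes "open S" "Ck_on k S f"
  shows "Ck_on k S (\<lambda>x. exp (f x))"
  using assms(2)
proof (induction k)
  case 0
  then show ?case by (auto intro: continuous_on_exp)
next
  case (Suc k)
  have D: "((\<lambda>x. exp (f x)) has_derivative (\<lambda>v. exp (f x) * frechet_derivative f (at x) v)) (at x)"
    if "x \<in> S" for x
  proof -
    have "(f has_derivative frechet_derivative f (at x)) (at x)"
      using Suc.prems that by (auto simp: frechet_derivative_works)
    moreover have "(exp has_derivative (\<lambda>v. exp (f x) * v)) (at (f x))"
      using DERIV_exp[of "f x"] by (simp add: has_field_derivative_def)
    ultimately show ?thesis
      using has_derivative_compose by blast
  qed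
  have "Ck_on k S (\<lambda>x. frechet_derivative (\<lambda>x. exp (f x)) (at x) v)" for v
    by (subst Ck_on_cong[OF \<open>open S\<close>, where g = "\<lambda>x. exp (f x) * frechet_derivative f (at x) v"])
       (use Suc frechet_derivative_eq[OF D] Ck_on_SucD in \<open>auto intro!: Ck_on_mult[OF \<open>open S\<close>] simp del: Ck_on.simps simp: Ck_on.simps(2)\<close>)
  then show ?case using D by (auto simp: differentiable_def)
qed

lemma smooth_on_differentiable: "smooth_on S f \<Longrightarrow> x \<in> S \<Longrightarrow> f differentiable (at x)"
  by (metis Ck_on.simps(2) smooth_on_def)

lemma smooth_on_has_derivative:
  "smooth_on S f \<Longrightarrow> x \<in> S \<Longrightarrow> (f has_derivative frechet_derivative f (at x)) (at x)"
  by (simp add: smooth_on_differentiable flip: frechet_derivative_works)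

lemma smooth_on_frechet_derivative:
  "smooth_on S f \<Longrightarrow> smooth_on S (\<lambda>x. frechet_derivative f (at x) v)"
  by (metis Ck_on.simps(2) smooth_on_def)

lemma smooth_on_continuous: "smooth_on S f \<Longrightarrow> continuous_on S f"
  by (metis Ck_on.simps(1) smooth_on_def)

lemma smooth_on_const: "smooth_on S (\<lambda>x. c)"
  by (simp add: smooth_on_def Ck_on_const)

lemma smooth_on_add: "open S \<Longrightarrow> smooth_on S f \<Longrightarrow> smooth_on S g \<Longrightarrow> smooth_on S (\<lambda>x. f x + g x)"
  by (simp add: smooth_on_def Ck_on_add)

lemma smooth_on_bounded_linear:
  "open S \<Longrightarrow> bounded_linear L \<Longrightarrow> smooth_on S f \<Longrightarrow> smooth_on S (\<lambda>x. L (f x))"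
  by (simp add: smooth_on_def Ck_on_bounded_linear)

lemma smooth_on_mult:
  fixes f g :: "'v::real_normed_vector \<Rightarrow> 'w::real_normed_algebra"
  shows "open S \<Longrightarrow> smooth_on S f \<Longrightarrow> smooth_on S g \<Longrightarrow> smooth_on S (\<lambda>x. f x * g x)"
  by (simp add: smooth_on_def Ck_on_mult)

lemma smooth_on_exp:
  fixes f :: "'v::real_normed_vector \<Rightarrow> 'w::{real_normed_field,banach}"
  shows "open S \<Longrightarrow> smooth_on S f \<Longrightarrow> smooth_on S (\<lambda>x. exp (f x))"
  by (simp add: smooth_on_def Ck_on_exp)

lemma smooth_on_sum:
  "open S \<Longrightarrow> (\<And>i. i \<in> A \<Longrightarrow> smooth_on S (f i)) \<Longrightarrow> smooth_on S (\<lambda>x. \<Sum>i\<in>A. f i x)"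
  by (induction A rule: infinite_finite_induct) (auto intro: smooth_on_const smooth_on_add)

text \<open>Two applications of the mean value theorem to the second difference of \<open>f\<close>.\<close>

lemma second_difference_mean_value:
  fixes f :: "'v::real_normed_vector \<Rightarrow> real"
  assumes f: "smooth_on S f" and h: "h > 0"
    and S: "\<And>s t. 0 \<le> s \<Longrightarrow> s \<le> h \<Longrightarrow> 0 \<le> t \<Longrightarrow> t \<le> h \<Longrightarrow> x + s *\<^sub>R u + t *\<^sub>R v \<in> S"
  shows "\<exists>s t. 0 < s \<and> s < h \<and> 0 < t \<and> t < h \<and>
    f (x + h *\<^sub>R u + h *\<^sub>R v) - f (x + h *\<^sub>R u) - f (x + h *\<^sub>R v) + f x =
      h * h * frechet_derivative (\<lambda>y. frechet_derivative f (at y) u) (at (x + s *\<^sub>R u + t *\<^sub>R v)) v"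
proof -
  let ?D = "\<lambda>y. frechet_derivative f (at y)"
  have lin: "linear (frechet_derivative g (at y))" if "smooth_on S g" "y \<in> S" for g :: "'v \<Rightarrow> real" and y
    using smooth_on_has_derivative[OF that] has_derivative_linear by blast
  define \<phi> where "\<phi> s = f (x + s *\<^sub>R u + h *\<^sub>R v) - f (x + s *\<^sub>R u)" for s
  have \<phi>: "(\<phi> has_real_derivative (?D (x + s *\<^sub>R u + h *\<^sub>R v) u - ?D (x + s *\<^sub>R u) u)) (at s)"
    if s: "0 \<le> s" "s \<le> h" for s
  proof -
    have S': "x + s *\<^sub>R u + h *\<^sub>R v \<in> S" "x + s *\<^sub>R u \<in> S"
      using S[of s h] S[of s 0] s h by auto
    have D: "((\<lambda>s. f (w + s *\<^sub>R u)) has_derivative (\<lambda>r. ?D (w + s *\<^sub>R u) (r *\<^sub>R u))) (at s)"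
      if "w + s *\<^sub>R u \<in> S" for w
    proof -
      have "((\<lambda>s. w + s *\<^sub>R u) has_derivative (\<lambda>r. r *\<^sub>R u)) (at s)"
        by (auto intro!: derivative_eq_intros)
      from has_derivative_compose[OF this smooth_on_has_derivative[OF f that]]
      show ?thesis .
    qed
    have "(\<phi> has_derivative (\<lambda>r. ?D (x + s *\<^sub>R u + h *\<^sub>R v) (r *\<^sub>R u) - ?D (x + s *\<^sub>R u) (r *\<^sub>R u))) (at s)"
      unfolding \<phi>_def using D[of "x + h *\<^sub>R v"] D[of x] S'
      by (intro has_derivative_diff) (simp_all add: add_ac)
    moreover have "(\<lambda>r. ?D (x + s *\<^sub>R u + h *\<^sub>R v) (r *\<^sub>R u) - ?D (x + s *\<^sub>R u) (r *\<^sub>R u)) =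
        (*) (?D (x + s *\<^sub>R u + h *\<^sub>R v) u - ?D (x + s *\<^sub>R u) u)"
      using lin[OF f S'(1)] lin[OF f S'(2)] by (auto simp: linear_scale algebra_simps)
    ultimately show ?thesis by (simp add: has_field_derivative_def)
  qed
  from MVT2[of 0 h \<phi>, OF h \<phi>] obtain s where s: "0 < s" "s < h"
    "\<phi> h - \<phi> 0 = h * (?D (x + s *\<^sub>R u + h *\<^sub>R v) u - ?D (x + s *\<^sub>R u) u)"
    by auto
  let ?g = "\<lambda>y. ?D y u"
  have g: "smooth_on S ?g" by (rule smooth_on_frechet_derivative[OF f])
  define \<psi> where "\<psi> t = ?g (x + s *\<^sub>R u + t *\<^sub>R v)" for t
  have \<psi>: "(\<psi> has_real_derivative frechet_derivative ?g (at (x + s *\<^sub>R u + t *\<^sub>R v)) v) (at t)"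
    if t: "0 \<le> t" "t \<le> h" for t
  proof -
    have S': "x + s *\<^sub>R u + t *\<^sub>R v \<in> S"
      using S[of s t] s t by auto
    have "((\<lambda>t. x + s *\<^sub>R u + t *\<^sub>R v) has_derivative (\<lambda>r. r *\<^sub>R v)) (at t)"
      by (auto intro!: derivative_eq_intros)
    from has_derivative_compose[OF this smooth_on_has_derivative[OF g S']]
    have "(\<psi> has_derivative (\<lambda>r. frechet_derivative ?g (at (x + s *\<^sub>R u + t *\<^sub>R v)) (r *\<^sub>R v))) (at t)"
      by (simp add: \<psi>_def[abs_def])
    moreover have "(\<lambda>r. frechet_derivative ?g (at (x + s *\<^sub>R u + t *\<^sub>R v)) (r *\<^sub>R v)) =
        (*) (frechet_derivative ?g (at (x + s *\<^sub>R u + t *\<^sub>R v)) v)"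
      using lin[OF g S'] by (auto simp: linear_scale)
    ultimately show ?thesis by (simp add: has_field_derivative_def)
  qed
  from MVT2[of 0 h \<psi>, OF h \<psi>] obtain t where t: "0 < t" "t < h"
    "\<psi> h - \<psi> 0 = h * frechet_derivative ?g (at (x + s *\<^sub>R u + t *\<^sub>R v)) v"
    by auto
  have "f (x + h *\<^sub>R u + h *\<^sub>R v) - f (x + h *\<^sub>R u) - f (x + h *\<^sub>R v) + f x = \<phi> h - \<phi> 0"
    by (simp add: \<phi>_def)
  also have "\<dots> = h * (\<psi> h - \<psi> 0)"
    using s(3) by (simp add: \<psi>_def)
  finally show ?thesis using s t by (intro exI[of _ s] exI[of _ t]) simp
qed

text \<open>The second difference is symmetric in \<open>u\<close> and \<open>v\<close>. It equals h
  * h times either mixed derivative, taken at points close to \<open>x\<close>, and continuity of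
  both mixed derivatives moves these points to \<open>x\<close>.\<close>

lemma symmetric_second_derivative_real:
  fixes f :: "'v::real_normed_vector \<Rightarrow> real"
  assumes "open S" "x \<in> S" "smooth_on S f"
  shows "frechet_derivative (\<lambda>y. frechet_derivative f (at y) u) (at x) v =
    frechet_derivative (\<lambda>y. frechet_derivative f (at y) v) (at x) u"
proof -
  let ?D = "\<lambda>u v y. frechet_derivative (\<lambda>y. frechet_derivative f (at y) u) (at y) v"
  obtain r where r: "r > 0" "ball x r \<subseteq> S"
    using assms(1,2) open_contains_ball by blast
  have small: "norm (s *\<^sub>R u + t *\<^sub>R v) \<le> h * (norm u + norm v)" if "0 \<le> s" "s \<le> h" "0 \<le> t" "t \<le> h" for s t h
    using norm_triangle_ineq[of "s *\<^sub>R u" "t *\<^sub>R v"] that mult_right_mono[of s h "norm u"] mult_right_mono[of t h "norm v"]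
    by (simp add: distrib_left)
  have close: "\<bar>?D u v x - ?D v u x\<bar> \<le> 2 * e" if e: "e > 0" for e
  proof -
    have cont: "isCont (?D a b) x" for a b
      using smooth_on_continuous[OF smooth_on_frechet_derivative[OF smooth_on_frechet_derivative[OF assms(3)]]]
        assms(1,2) continuous_on_eq_continuous_at by blast
    obtain d1 where d1: "d1 > 0" "\<And>y. dist y x < d1 \<Longrightarrow> dist (?D u v y) (?D u v x) < e"
      using cont[of u v] e unfolding continuous_at_eps_delta by blast
    obtain d2 where d2: "d2 > 0" "\<And>y. dist y x < d2 \<Longrightarrow> dist (?D v u y) (?D v u x) < e"
      using cont[of v u] e unfolding continuous_at_eps_delta by blast
    define m where "m = Min {r, d1, d2}"
    have m: "m > 0" "m \<le> r" "m \<le> d1" "m \<le> d2" using r d1 d2 by (auto simp: m_def)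
    \<comment> \<open>Chosen so that the whole parallelogram with sides \<open>h *\<^sub>R u\<close>
      and \<open>h *\<^sub>R v\<close> stays within \<open>m\<close> of \<open>x\<close>; the
      summand 1 keeps the denominator positive when \<open>u\<close> and \<open>v\<close>
      vanish.\<close>
    define h where "h = m / (norm u + norm v + 1)"
    have h: "h > 0" using m by (auto simp: h_def intro!: divide_pos_pos add_nonneg_pos)
    have "h * (norm u + norm v) < h * (norm u + norm v + 1)" using h by simp
    also have "\<dots> = m" using m unfolding h_def by (simp add: add_nonneg_eq_0_iff)
    finally have hm: "h * (norm u + norm v) < m" .
    have near: "dist (x + s *\<^sub>R u + t *\<^sub>R v) x < m" "dist (x + t *\<^sub>R v + s *\<^sub>R u) x < m"
      if "0 \<le> s" "s \<le> h" "0 \<le> t" "t \<le> h" for s t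
      using small[OF that] hm by (simp_all add: dist_norm add_ac)
    have S1: "x + s *\<^sub>R u + t *\<^sub>R v \<in> S" if "0 \<le> s" "s \<le> h" "0 \<le> t" "t \<le> h" for s t
      using near(1)[OF that] m r by (auto simp: dist_commute)
    have S2: "x + t *\<^sub>R v + s *\<^sub>R u \<in> S" if "0 \<le> t" "t \<le> h" "0 \<le> s" "s \<le> h" for s t
      using near(2)[of s t] that m r by (auto simp: dist_commute)
    obtain s t where 1: "0 < s" "s < h" "0 < t" "t < h"
      "f (x + h *\<^sub>R u + h *\<^sub>R v) - f (x + h *\<^sub>R u) - f (x + h *\<^sub>R v) + f x =
        h * h * ?D u v (x + s *\<^sub>R u + t *\<^sub>R v)"
      using second_difference_mean_value[OF assms(3) h S1] by blast
    obtain s' t' where 2: "0 < s'" "s' < h" "0 < t'" "t' < h"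
      "f (x + h *\<^sub>R v + h *\<^sub>R u) - f (x + h *\<^sub>R v) - f (x + h *\<^sub>R u) + f x =
        h * h * ?D v u (x + s' *\<^sub>R v + t' *\<^sub>R u)"
      using second_difference_mean_value[OF assms(3) h S2] by blast
    have "h * h * ?D u v (x + s *\<^sub>R u + t *\<^sub>R v) = h * h * ?D v u (x + s' *\<^sub>R v + t' *\<^sub>R u)"
    proof -
      have "f (x + h *\<^sub>R v + h *\<^sub>R u) = f (x + h *\<^sub>R u + h *\<^sub>R v)" by (simp add: add_ac)
      then show ?thesis using 1(5) 2(5) by linarith
    qed
    then have "?D u v (x + s *\<^sub>R u + t *\<^sub>R v) = ?D v u (x + s' *\<^sub>R v + t' *\<^sub>R u)"
      using h by simp
    moreover have "dist (?D u v (x + s *\<^sub>R u + t *\<^sub>R v)) (?D u v x) < e"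
      using near(1)[of s t] 1 m by (intro d1(2)) auto
    moreover have "dist (?D v u (x + s' *\<^sub>R v + t' *\<^sub>R u)) (?D v u x) < e"
      using near(2)[of t' s'] 2 m by (intro d2(2)) auto
    ultimately show ?thesis by (simp add: dist_real_def)
  qed
  show ?thesis
  proof (rule ccontr)
    assume "?D u v x \<noteq> ?D v u x"
    then show False using close[of "\<bar>?D u v x - ?D v u x\<bar> / 3"] by simp
  qed
qed

text \<open>\<open>Re\<close> and \<open>Im\<close> are bounded linear and so pass through both
  derivatives, which reduces the claim to real functions.\<close>

lemma symmetric_second_derivative:
  fixes f :: "'v::real_normed_vector \<Rightarrow> complex"
  assumes S: "open S" "x \<in> S" and f: "smooth_on S f"
  shows "frechet_derivative (\<lambda>y. frechet_derivative f (at y) u) (at x) v =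
    frechet_derivative (\<lambda>y. frechet_derivative f (at y) v) (at x) u"
proof -
  have *: "L (frechet_derivative (\<lambda>y. frechet_derivative f (at y) u) (at x) v) =
      frechet_derivative (\<lambda>y. frechet_derivative (\<lambda>z. L (f z)) (at y) u) (at x) v"
    if L: "bounded_linear L" for L :: "complex \<Rightarrow> real" and u v
  proof -
    have 1: "frechet_derivative (\<lambda>z. L (g z)) (at y) w = L (frechet_derivative g (at y) w)"
      if "smooth_on S g" "y \<in> S" for g y w
      using bounded_linear.has_derivative[OF L smooth_on_has_derivative[OF that]] frechet_derivative_eq
      by metis
    have "frechet_derivative (\<lambda>y. frechet_derivative (\<lambda>z. L (f z)) (at y) u) (at x) =
        frechet_derivative (\<lambda>y. L (frechet_derivative f (at y) u)) (at x)"
      using S by (rule frechet_derivative_cong_open) (rule 1[OF f])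
    then show ?thesis
      using 1[OF smooth_on_frechet_derivative[OF f] S(2)] by simp
  qed
  show ?thesis
    by (rule complex_eqI; subst (1 2) *)
       (auto intro: bounded_linear_Re bounded_linear_Im
          symmetric_second_derivative_real[OF S] smooth_on_bounded_linear[OF S(1) _ f])
qed

section \<open>Differential forms on an open set\<close>

text \<open>\<open>\<epsilon> = - \<i>\<close> gives the Wirtinger derivative and \<open>\<epsilon> = \<i>\<close> its conjugate.\<close>

definition wirt :: "complex \<Rightarrow> 'n::finite \<Rightarrow> (complex^'n \<Rightarrow> complex) \<Rightarrow> complex^'n \<Rightarrow> complex" where
  "wirt \<epsilon> i F z =
     (frechet_derivative F (at z) (axis i 1) + \<epsilon> * frechet_derivative F (at z) (axis i \<i>)) / 2"

lemma wirt_cong: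
  "open S \<Longrightarrow> z \<in> S \<Longrightarrow> (\<And>y. y \<in> S \<Longrightarrow> F y = G y) \<Longrightarrow> wirt \<epsilon> i F z = wirt \<epsilon> i G z"
  unfolding wirt_def using frechet_derivative_cong_open[of S z F G] by simp

lemma wirt_const [simp]: "wirt \<epsilon> i (\<lambda>z. c) z = 0"
  by (simp add: wirt_def)

lemma wirt_add:
  assumes "F differentiable (at z)" "G differentiable (at z)"
  shows "wirt \<epsilon> i (\<lambda>z. F z + G z) z = wirt \<epsilon> i F z + wirt \<epsilon> i G z"
  using frechet_derivative_eq[OF has_derivative_add[OF assms[unfolded frechet_derivative_works]]]
  by (simp add: wirt_def field_simps)

lemma wirt_mult:
  assumes "F differentiable (at z)" "G differentiable (at z)"
  shows "wirt \<epsilon> i (\<lambda>z. F z * G z) z = wirt \<epsilon> i F z * G z + F z * wirt \<epsilon> i G z"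
  using frechet_derivative_eq[OF has_derivative_mult[OF assms[unfolded frechet_derivative_works]]]
  by (simp add: wirt_def field_simps)

lemma wirt_sum:
  "finite A \<Longrightarrow> (\<And>x. x \<in> A \<Longrightarrow> F x differentiable (at z)) \<Longrightarrow>
    wirt \<epsilon> i (\<lambda>z. \<Sum>x\<in>A. F x z) z = (\<Sum>x\<in>A. wirt \<epsilon> i (F x) z)"
  by (induction A rule: finite_induct) (auto simp: wirt_add)

lemma wirt_exp:
  assumes "F differentiable (at z)"
  shows "wirt \<epsilon> i (\<lambda>z. exp (F z)) z = exp (F z) * wirt \<epsilon> i F z"
proof -
  have "(exp has_derivative (\<lambda>v. exp (F z) * v)) (at (F z))"
    using DERIV_exp[of "F z"] by (simp add: has_field_derivative_def)
  from has_derivative_compose[OF assms[unfolded frechet_derivative_works] this]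
  show ?thesis by (simp add: wirt_def frechet_derivative_eq field_simps)
qed

lemma smooth_on_wirt:
  assumes "open S" "smooth_on S F"
  shows "smooth_on S (wirt \<epsilon> i F)"
proof -
  have "smooth_on S (\<lambda>z. (frechet_derivative F (at z) (axis i 1) +
      \<epsilon> * frechet_derivative F (at z) (axis i \<i>)) * (1 / 2))"
    by (intro smooth_on_add smooth_on_mult smooth_on_const smooth_on_frechet_derivative assms)
  then show ?thesis by (simp add: wirt_def[abs_def])
qed

text \<open>Each operator is a combination of two directional derivatives with constant
  coefficients. The independent parameters \<epsilon> and \<delta> cover holomorphic,
  antiholomorphic and mixed second derivatives at once.\<close>

lemma wirt_commute:
  fixes F :: "complex^'n::finite \<Rightarrow> complex"
  assumes "open S" "z \<in> S" "smooth_on S F"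
  shows "wirt \<epsilon> i (wirt \<delta> j F) z = wirt \<delta> j (wirt \<epsilon> i F) z"
proof -
  let ?D = "\<lambda>u v. frechet_derivative (\<lambda>y. frechet_derivative F (at y) u) (at z) v"
  have "frechet_derivative (wirt \<epsilon> i F) (at z) v = (?D (axis i 1) v + \<epsilon> * ?D (axis i \<i>) v) / 2"
    for \<epsilon> v and i :: 'n
  proof -
    let ?g = "\<lambda>y. frechet_derivative F (at y) (axis i 1)" and ?h = "\<lambda>y. frechet_derivative F (at y) (axis i \<i>)"
    have gh: "(?g has_derivative frechet_derivative ?g (at z)) (at z)"
      "(?h has_derivative frechet_derivative ?h (at z)) (at z)"
      using smooth_on_has_derivative[OF smooth_on_frechet_derivative[OF assms(3)] assms(2)] by blast+
    have "(wirt \<epsilon> i F has_derivative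
        (\<lambda>v. (1 / 2) * frechet_derivative ?g (at z) v + (\<epsilon> / 2) * frechet_derivative ?h (at z) v)) (at z)"
    proof (rule has_derivative_eq_rhs)
      show "(wirt \<epsilon> i F has_derivative
          (\<lambda>v. (frechet_derivative ?g (at z) v + \<epsilon> * frechet_derivative ?h (at z) v) / 2)) (at z)"
        unfolding wirt_def[abs_def]
        using has_derivative_mult_right[of "\<lambda>y. ?g y + \<epsilon> * ?h y" _ "at z" "1/2",
            OF has_derivative_add[OF gh(1) has_derivative_mult_right[OF gh(2), of \<epsilon>]]]
        by (simp add: field_simps)
    qed (auto simp: field_simps)
    then show ?thesis by (simp add: frechet_derivative_eq field_simps)
  qed
  note * = this
  have "?D u v = ?D v u" for u v by (rule symmetric_second_derivative[OF assms])
  then show ?thesis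
    by (simp add: wirt_def[of _ _ "wirt _ _ _"] * algebra_simps) (simp add: add_divide_distrib)
qed

section \<open>First order operators on forms\<close>

definition coord_deriv ::
  "complex \<Rightarrow> 'n::finite \<Rightarrow> (complex^'n \<Rightarrow> 'n cform) \<Rightarrow> complex^'n \<Rightarrow> 'n cform" where
  "coord_deriv \<epsilon> i W z = Form (\<lambda>T. wirt \<epsilon> i (\<lambda>y. coeff (W y) T) z)"

text \<open>With \<epsilon> = - \<i> and \<theta> = \<open>dz\<close> this is \<partial>, with
  \<epsilon> = \<i> and \<theta> = \<open>dzbar\<close> it is \<partial>'. The calculus is developed
  once for both.\<close>

definition form_deriv ::
  "complex \<Rightarrow> ('n \<Rightarrow> 'n cform) \<Rightarrow> (complex^'n::{finite,linorder} \<Rightarrow> 'n cform) \<Rightarrow>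
    complex^'n::{finite,linorder} \<Rightarrow> 'n cform" where
  "form_deriv \<epsilon> \<theta> W z = (\<Sum>i\<in>UNIV. \<theta> i * coord_deriv \<epsilon> i W z)"

definition smooth_form :: "(complex^'n::finite) set \<Rightarrow> (complex^'n \<Rightarrow> 'n cform) \<Rightarrow> bool" where
  "smooth_form S W \<longleftrightarrow> (\<forall>T. smooth_on S (\<lambda>z. coeff (W z) T))"

lemma smooth_formD: "smooth_form S W \<Longrightarrow> smooth_on S (\<lambda>z. coeff (W z) T)"
  by (simp add: smooth_form_def)

lemma coeff_coord_deriv [simp]:
  "coeff (coord_deriv \<epsilon> i W z) T = wirt \<epsilon> i (\<lambda>y. coeff (W y) T) z"
  by (simp add: coord_deriv_def)

locale open_domain =
  fixes S :: "(complex^'n::{finite,linorder}) set"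
  assumes open_S: "open S"
begin

lemma smooth_form_const [intro]: "smooth_form S (\<lambda>z. c)"
  by (auto simp: smooth_form_def intro: smooth_on_const)

lemma smooth_form_scalar [intro]: "smooth_on S \<phi> \<Longrightarrow> smooth_form S (\<lambda>z. scalar (\<phi> z))"
  unfolding smooth_form_def coeff_scalar
  by (intro allI, rename_tac T, case_tac "T = {}") (simp_all add: smooth_on_const)

lemma smooth_form_add [intro]:
  "smooth_form S V \<Longrightarrow> smooth_form S W \<Longrightarrow> smooth_form S (\<lambda>z. V z + W z)"
  by (auto simp: smooth_form_def intro: smooth_on_add open_S)

lemma smooth_form_mult [intro]:
  "smooth_form S V \<Longrightarrow> smooth_form S W \<Longrightarrow> smooth_form S (\<lambda>z. V z * W z)"
  by (auto simp: smooth_form_def cform_coeff_times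
      intro!: smooth_on_sum smooth_on_mult smooth_on_const open_S)

lemma smooth_form_uminus [intro]: "smooth_form S V \<Longrightarrow> smooth_form S (\<lambda>z. - V z)"
  using smooth_form_mult[OF smooth_form_const[of "-1"], of V] by simp

lemma smooth_form_diff [intro]:
  "smooth_form S V \<Longrightarrow> smooth_form S W \<Longrightarrow> smooth_form S (\<lambda>z. V z - W z)"
  using smooth_form_add[OF _ smooth_form_uminus, of V W] by simp

lemma smooth_form_sum [intro]:
  "(\<And>i. i \<in> A \<Longrightarrow> smooth_form S (V i)) \<Longrightarrow> smooth_form S (\<lambda>z. \<Sum>i\<in>A. V i z)"
  by (auto simp: smooth_form_def intro!: smooth_on_sum open_S)

lemma smooth_form_power [intro]: "smooth_form S V \<Longrightarrow> smooth_form S (\<lambda>z. V z ^ k)"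
  by (induction k) auto

lemma smooth_form_coord_deriv [intro]: "smooth_form S W \<Longrightarrow> smooth_form S (coord_deriv \<epsilon> i W)"
  unfolding smooth_form_def coeff_coord_deriv using smooth_on_wirt[OF open_S] by blast

lemma smooth_form_form_deriv [intro]: "smooth_form S W \<Longrightarrow> smooth_form S (form_deriv \<epsilon> \<theta> W)"
  unfolding form_deriv_def[abs_def]
  by (intro smooth_form_sum smooth_form_mult smooth_form_const smooth_form_coord_deriv)

lemma coord_deriv_cong:
  "z \<in> S \<Longrightarrow> (\<And>y. y \<in> S \<Longrightarrow> V y = W y) \<Longrightarrow> coord_deriv \<epsilon> i V z = coord_deriv \<epsilon> i W z"
  by (intro cform_eqI) (auto intro: wirt_cong[OF open_S])

lemma form_deriv_cong:
  "z \<in> S \<Longrightarrow> (\<And>y. y \<in> S \<Longrightarrow> V y = W y) \<Longrightarrow> form_deriv \<epsilon> \<theta> V z = form_deriv \<epsilon> \<theta> W z"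
  unfolding form_deriv_def using coord_deriv_cong[of z V W] by simp

lemma coord_deriv_const [simp]: "coord_deriv \<epsilon> i (\<lambda>z. c) z = 0"
  by (rule cform_eqI) simp

lemma differentiable_coeff:
  "smooth_form S W \<Longrightarrow> z \<in> S \<Longrightarrow> (\<lambda>z. coeff (W z) T) differentiable (at z)"
  using smooth_formD smooth_on_differentiable by blast

lemma coord_deriv_add:
  "z \<in> S \<Longrightarrow> smooth_form S V \<Longrightarrow> smooth_form S W \<Longrightarrow>
    coord_deriv \<epsilon> i (\<lambda>z. V z + W z) z = coord_deriv \<epsilon> i V z + coord_deriv \<epsilon> i W z"
  by (intro cform_eqI) (simp add: wirt_add differentiable_coeff)

text \<open>No sign appears: only coefficients are differentiated, and the wedge signs are
  constants. Signs enter in \<open>D_mult\<close>, when the generator \<theta> has to pass the first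
  factor.\<close>

lemma coord_deriv_mult:
  assumes "z \<in> S" "smooth_form S V" "smooth_form S W"
  shows "coord_deriv \<epsilon> i (\<lambda>z. V z * W z) z = coord_deriv \<epsilon> i V z * W z + V z * coord_deriv \<epsilon> i W z"
proof (rule cform_eqI)
  fix T
  note diff = differentiable_coeff[OF assms(2,1)] differentiable_coeff[OF assms(3,1)]
  have "wirt \<epsilon> i (\<lambda>z. \<Sum>R\<in>Pow T. wedge_sign R (T - R) * coeff (V z) R * coeff (W z) (T - R)) z =
      (\<Sum>R\<in>Pow T. wirt \<epsilon> i (\<lambda>z. wedge_sign R (T - R) * coeff (V z) R * coeff (W z) (T - R)) z)"
    by (rule wirt_sum) (auto intro!: differentiable_mult diff)
  also have "\<dots> = (\<Sum>R\<in>Pow T. wedge_sign R (T - R) * wirt \<epsilon> i (\<lambda>z. coeff (V z) R) z * coeff (W z) (T - R) +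
      wedge_sign R (T - R) * coeff (V z) R * wirt \<epsilon> i (\<lambda>z. coeff (W z) (T - R)) z)"
    by (simp add: wirt_mult diff differentiable_mult)
  finally show "coeff (coord_deriv \<epsilon> i (\<lambda>z. V z * W z) z) T =
      coeff (coord_deriv \<epsilon> i V z * W z + V z * coord_deriv \<epsilon> i W z) T"
    by (simp add: cform_coeff_times sum.distrib)
qed

lemma coord_deriv_sum:
  assumes "z \<in> S" "finite A" "\<And>x. x \<in> A \<Longrightarrow> smooth_form S (V x)"
  shows "coord_deriv \<epsilon> i (\<lambda>z. \<Sum>x\<in>A. V x z) z = (\<Sum>x\<in>A. coord_deriv \<epsilon> i (V x) z)"
  by (intro cform_eqI) (simp add: wirt_sum differentiable_coeff assms)

text \<open>A coefficient that is forbidden by the type vanishes on all of \<open>S\<close>, hence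
  so does its derivative.\<close>

lemma form_type_coord_deriv:
  assumes "z \<in> S" "\<And>y. y \<in> S \<Longrightarrow> form_type p q (W y)"
  shows "form_type p q (coord_deriv \<epsilon> i W z)"
  unfolding form_type_def
proof (intro allI impI)
  fix T assume *: "coeff (coord_deriv \<epsilon> i W z) T \<noteq> 0"
  show "card (Inl -` T) = p \<and> card (Inr -` T) = q"
  proof (rule ccontr)
    assume "\<not> ?thesis"
    then have "wirt \<epsilon> i (\<lambda>y. coeff (W y) T) z = wirt \<epsilon> i (\<lambda>y. 0) z"
      using assms by (intro wirt_cong[OF open_S]) (auto simp: form_type_def)
    then show False using * by simp
  qed
qed

lemma coord_deriv_commute:
  assumes "z \<in> S" "smooth_form S W"
  shows "coord_deriv \<epsilon> i (coord_deriv \<delta> j W) z = coord_deriv \<delta> j (coord_deriv \<epsilon> i W) z"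
  by (intro cform_eqI) (simp add: wirt_commute[OF open_S assms(1) smooth_formD[OF assms(2)]])

lemma form_deriv_form_deriv:
  assumes "z \<in> S" "smooth_form S W"
  shows "form_deriv \<epsilon> \<theta> (form_deriv \<delta> \<eta> W) z =
    (\<Sum>i\<in>UNIV. \<Sum>j\<in>UNIV. \<theta> i * \<eta> j * coord_deriv \<epsilon> i (coord_deriv \<delta> j W) z)"
proof -
  have "coord_deriv \<epsilon> i (form_deriv \<delta> \<eta> W) z = (\<Sum>j\<in>UNIV. \<eta> j * coord_deriv \<epsilon> i (coord_deriv \<delta> j W) z)" for i
    unfolding form_deriv_def[abs_def] using assms
    by (auto simp: coord_deriv_sum coord_deriv_mult smooth_form_mult smooth_form_const smooth_form_coord_deriv)
  then show ?thesis
    by (simp add: form_deriv_def sum_distrib_left mult.assoc)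
qed

text \<open>Second coordinate derivatives are symmetric while the generators anticommute. Both D D =
  0 and \<partial>' \<partial> = - \<partial> \<partial>' are instances.\<close>

lemma form_deriv_anticommute:
  assumes "z \<in> S" "smooth_form S W" "\<And>i j. \<eta> j * \<theta> i = - (\<theta> i * \<eta> j)"
  shows "form_deriv \<delta> \<eta> (form_deriv \<epsilon> \<theta> W) z = - form_deriv \<epsilon> \<theta> (form_deriv \<delta> \<eta> W) z"
proof -
  have "form_deriv \<delta> \<eta> (form_deriv \<epsilon> \<theta> W) z =
      (\<Sum>j\<in>UNIV. \<Sum>i\<in>UNIV. - (\<theta> i * \<eta> j * coord_deriv \<epsilon> i (coord_deriv \<delta> j W) z))"
    unfolding form_deriv_form_deriv[OF assms(1,2)]
    by (simp add: assms(3) coord_deriv_commute[OF assms(1,2)])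
  also have "\<dots> = - form_deriv \<epsilon> \<theta> (form_deriv \<delta> \<eta> W) z"
    unfolding form_deriv_form_deriv[OF assms(1,2)]
    by (subst sum.swap) (simp add: sum_negf)
  finally show ?thesis .
qed

end

text \<open>The pair (a, b) is the bidegree of the operator: (1, 0) for \<partial> and (0, 1) for
  \<partial>'.\<close>

locale dolbeault_operator = open_domain S for S :: "(complex^'n::{finite,linorder}) set" +
  fixes \<epsilon> :: complex and \<theta> :: "'n \<Rightarrow> 'n cform" and a b :: nat
  assumes type_\<theta>: "form_type a b (\<theta> i)" and degree_one: "a + b = 1"
begin

abbreviation "D \<equiv> form_deriv \<epsilon> \<theta>"

lemma form_type_D:
  assumes "z \<in> S" "\<And>y. y \<in> S \<Longrightarrow> form_type p q (W y)"
  shows "form_type (a + p) (b + q) (D W z)"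
  unfolding form_deriv_def using assms
  by (intro form_type_sum form_type_mult type_\<theta> form_type_coord_deriv)

lemma D_const [simp]: "D (\<lambda>z. c) z = 0"
  by (simp add: form_deriv_def)

lemma D_add:
  "z \<in> S \<Longrightarrow> smooth_form S V \<Longrightarrow> smooth_form S W \<Longrightarrow> D (\<lambda>z. V z + W z) z = D V z + D W z"
  by (simp add: form_deriv_def coord_deriv_add distrib_left sum.distrib)

text \<open>The scalar \<open>c\<close> is the sign picked up when \<theta> passes
  \<open>V z\<close>: 1 for an even and -1 for an odd first factor.\<close>

lemma D_mult:
  assumes "z \<in> S" "smooth_form S V" "smooth_form S W" "\<And>i. \<theta> i * V z = scalar c * (V z * \<theta> i)"
  shows "D (\<lambda>z. V z * W z) z = D V z * W z + scalar c * (V z * D W z)"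
proof -
  have "\<theta> i * V z * X = scalar c * (V z * (\<theta> i * X))" for i X
    by (simp add: assms(4) mult.assoc)
  then show ?thesis
    using assms(1-3)
    by (simp add: form_deriv_def coord_deriv_mult distrib_left sum.distrib sum_distrib_left sum_distrib_right
        flip: mult.assoc)
qed

lemma D_mult_even:
  "z \<in> S \<Longrightarrow> smooth_form S V \<Longrightarrow> smooth_form S W \<Longrightarrow> even_form (V z) \<Longrightarrow>
    D (\<lambda>z. V z * W z) z = D V z * W z + V z * D W z"
  using D_mult[of z V W 1] by (simp add: even_form_commute)

lemma D_mult_odd:
  assumes "z \<in> S" "smooth_form S V" "smooth_form S W" "form_type p q (V z)" "odd (p + q)"
  shows "D (\<lambda>z. V z * W z) z = D V z * W z - V z * D W z"
proof -
  have "\<theta> i * V z = scalar (-1) * (V z * \<theta> i)" for i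
    using form_type_anticommute[OF assms(4) type_\<theta>[of i] assms(5)] degree_one
    by (simp add: scalar_uminus)
  from D_mult[OF assms(1-3) this] show ?thesis by (simp add: scalar_uminus)
qed

lemma D_scalar_mult:
  "z \<in> S \<Longrightarrow> smooth_on S \<phi> \<Longrightarrow> smooth_form S W \<Longrightarrow>
    D (\<lambda>z. scalar (\<phi> z) * W z) z = D (\<lambda>z. scalar (\<phi> z)) z * W z + scalar (\<phi> z) * D W z"
  by (rule D_mult_even) (auto intro: form_type_even_form[OF form_type_scalar])

lemma D_cmult: "z \<in> S \<Longrightarrow> smooth_form S W \<Longrightarrow> D (\<lambda>z. scalar c * W z) z = scalar c * D W z"
  using D_scalar_mult[of z "\<lambda>_. c" W] by (simp add: smooth_on_const)

lemma D_uminus: "z \<in> S \<Longrightarrow> smooth_form S W \<Longrightarrow> D (\<lambda>z. - W z) z = - D W z"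
  using D_cmult[of z W "-1"] by (simp add: scalar_uminus)

lemma D_diff:
  "z \<in> S \<Longrightarrow> smooth_form S V \<Longrightarrow> smooth_form S W \<Longrightarrow> D (\<lambda>z. V z - W z) z = D V z - D W z"
  using D_add[of z V "\<lambda>z. - W z"] by (auto simp: D_uminus)

lemma D_sum:
  assumes "z \<in> S" "finite A" "\<And>x. x \<in> A \<Longrightarrow> smooth_form S (V x)"
  shows "D (\<lambda>z. \<Sum>x\<in>A. V x z) z = (\<Sum>x\<in>A. D (V x) z)"
  using assms by (simp add: form_deriv_def coord_deriv_sum sum_distrib_left) (rule sum.swap)

lemma D_exp:
  assumes "z \<in> S" "smooth_on S \<phi>"
  shows "D (\<lambda>z. scalar (exp (\<phi> z))) z = scalar (exp (\<phi> z)) * D (\<lambda>z. scalar (\<phi> z)) z"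
proof -
  have "coord_deriv \<epsilon> i (\<lambda>z. scalar (exp (\<phi> z))) z = scalar (exp (\<phi> z)) * coord_deriv \<epsilon> i (\<lambda>z. scalar (\<phi> z)) z" for i
  proof (rule cform_eqI)
    fix T
    show "coeff (coord_deriv \<epsilon> i (\<lambda>z. scalar (exp (\<phi> z))) z) T =
        coeff (scalar (exp (\<phi> z)) * coord_deriv \<epsilon> i (\<lambda>z. scalar (\<phi> z)) z) T"
      using smooth_on_differentiable[OF assms(2,1)]
      by (cases "T = {}") (simp_all add: coeff_scalar wirt_exp)
  qed
  then show ?thesis by (simp add: form_deriv_def sum_distrib_left scalar_left_commute)
qed

lemma D_power:
  assumes z: "z \<in> S" and V: "smooth_form S V" "\<And>y. y \<in> S \<Longrightarrow> even_form (V y)"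
  shows "D (\<lambda>z. V z ^ Suc k) z = scalar (of_nat (Suc k)) * (V z ^ k * D V z)"
proof (induction k)
  case 0
  then show ?case by simp
next
  case (Suc k)
  have "D (\<lambda>z. V z ^ Suc (Suc k)) z = D (\<lambda>z. V z * V z ^ Suc k) z" by simp
  also have "\<dots> = D V z * V z ^ Suc k + V z * D (\<lambda>z. V z ^ Suc k) z"
    using z V by (intro D_mult_even smooth_form_power) auto
  also have "D V z * V z ^ Suc k = V z ^ Suc k * D V z"
    using V(2)[OF z] by (intro even_form_commute even_form_power)
  finally have "D (\<lambda>z. V z ^ Suc (Suc k)) z =
      (1 + scalar (of_nat (Suc k))) * (V z ^ Suc k * D V z)"
    unfolding Suc.IH by (simp add: scalar_left_commute mult.assoc distrib_right del: of_nat_Suc)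
  moreover have "scalar (of_nat (Suc (Suc k))) = 1 + (scalar (of_nat (Suc k)) :: 'n cform)"
    by (simp add: scalar_of_nat del: of_nat_Suc) (simp add: add.assoc)
  ultimately show ?case by simp
qed

text \<open>Anticommutation of the operator with itself makes every coefficient equal to its
  negative.\<close>

lemma D_D:
  assumes "z \<in> S" "smooth_form S W"
  shows "D (D W) z = 0"
proof -
  have "D (D W) z = - D (D W) z"
    by (intro form_deriv_anticommute[OF assms] form_type_anticommute[OF type_\<theta> type_\<theta>])
       (simp_all add: degree_one)
  then have "coeff (D (D W) z) T = - coeff (D (D W) z) T" for T
    by (metis cform_coeff_uminus)
  then show ?thesis by (intro cform_eqI) simp
qed

end

section \<open>The metric in a chart\<close>

lemma form_type_square_zero:
  fixes a :: "'n::{finite,linorder} cform"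
  assumes "form_type p q a" "odd (p + q)"
  shows "a * a = 0"
proof (rule cform_eqI)
  fix T
  have "coeff (a * a) T = - coeff (a * a) T"
    using form_type_anticommute[OF assms(1) assms(1) assms(2) assms(2)] by (metis cform_coeff_uminus)
  then show "coeff (a * a) T = coeff 0 T" by simp
qed

text \<open>The index set in the definition of \<open>log_one_minus\<close> depends on
  \<open>a\<close>, hence on the point when \<open>a\<close> varies. A fixed range
  \<open>j < N\<close> makes termwise differentiation possible.\<close>

lemma log_one_minus_eq:
  fixes a :: "'n::{finite,linorder} cform"
  assumes "form_type 1 1 a" "N > CARD('n)"
  shows "log_one_minus a = - (\<Sum>j<N. scalar (1 / of_nat (Suc j)) * a ^ Suc j)"
proof -
  have zero: "a ^ j = 0" if "j \<ge> N" for j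
    using form_type_eq_zero[OF form_type_power[OF assms(1), of j]] assms(2) that by auto
  have "(\<Sum>j\<in>{j. 1 \<le> j \<and> a ^ j \<noteq> 0}. scalar (1 / of_nat j) * a ^ j) =
      (\<Sum>j\<in>Suc ` {..<N}. scalar (1 / of_nat j) * a ^ j)"
  proof (rule sum.mono_neutral_left)
    show "{j. 1 \<le> j \<and> a ^ j \<noteq> 0} \<subseteq> Suc ` {..<N}"
    proof
      fix j assume "j \<in> {j. 1 \<le> j \<and> a ^ j \<noteq> 0}"
      then have "j = Suc (j - 1)" "j - 1 < N" using zero[of j] by (force+)
      then show "j \<in> Suc ` {..<N}" by blast
    qed
  qed auto
  also have "\<dots> = (\<Sum>j<N. scalar (1 / of_nat (Suc j)) * a ^ Suc j)"
    by (subst sum.reindex) auto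
  finally show ?thesis by (simp add: log_one_minus_def)
qed

lemma geometric_sum_nilpotent:
  fixes a :: "'n::{finite,linorder} cform"
  assumes "form_type 1 1 a" "N > CARD('n)"
  shows "(\<Sum>j<N. a ^ j) * (1 - a) = 1"
proof -
  have "a ^ N = 0"
    using form_type_eq_zero[OF form_type_power[OF assms(1), of N]] assms(2) by simp
  moreover have "(\<Sum>j<N. a ^ j) * (1 - a) = 1 - a ^ N"
  proof (induction N)
    case (Suc N)
    have "(\<Sum>j<Suc N. a ^ j) * (1 - a) = (\<Sum>j<N. a ^ j) * (1 - a) + a ^ N * (1 - a)"
      by (simp only: sum.lessThan_Suc distrib_right)
    also have "\<dots> = 1 - a ^ Suc N"
      unfolding Suc.IH by (simp add: right_diff_distrib power_Suc2 del: power_Suc)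
    finally show ?case .
  qed simp
  ultimately show ?thesis by simp
qed

text \<open>Division by 1 - a for an arbitrary form \<open>x\<close>. It is applied to a derivative
  of an even form, which is odd and so lies outside the commutative ring.\<close>

lemma even_form_cancel:
  assumes "Q * (1 - a) = 1" "even_form a" "even_form Q" "x * (1 - a) = y"
  shows "x = Q * (y :: 'n::{finite,linorder} cform)"
proof -
  have "x = x * (Q * (1 - a))" using assms(1) by simp
  also have "\<dots> = Q * x * (1 - a)"
    by (simp add: even_form_commute[OF assms(3), of x] mult.assoc flip: mult.assoc)
  finally show ?thesis using assms(4) by (simp add: mult.assoc)
qed

section \<open>The functions of the metric in one chart and the forms derived from them\<close>

locale bundle_chart = open_domain S for S :: "(complex^'n::{finite,linorder}) set" +
  fixes m :: nat and F :: "nat \<Rightarrow> complex^'n::{finite,linorder} \<Rightarrow> complex"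
    and s :: "complex^'n::{finite,linorder} \<Rightarrow> complex"
  assumes smooth_F: "i < m \<Longrightarrow> smooth_on S (F i)" and smooth_s: "smooth_on S s"
begin

sublocale P: dolbeault_operator S "- \<i>" dz 1 0
  by unfold_locales (rule form_type_dz, simp)

sublocale Q: dolbeault_operator S "\<i>" dzbar 0 1
  by unfold_locales (rule form_type_dzbar, simp)

abbreviation "Del \<equiv> form_deriv (- \<i>) dz"
abbreviation "Delbar \<equiv> form_deriv \<i> dzbar"

definition "v i z = cnj (F i z)"
definition "\<alpha> i = Del (\<lambda>z. scalar (F i z))"
definition "\<beta> i = Delbar (\<lambda>z. scalar (v i z))"
definition "\<gamma> i = Del (\<lambda>z. scalar (v i z))"
definition "\<eta> = Del (\<lambda>z. scalar (s z))"
definition "a i z = scalar (exp (- s z)) * \<alpha> i z"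
definition "R i = Delbar (a i)"
definition "C i z = Delbar (\<gamma> i) z - \<beta> i z * \<eta> z"
definition "U z = (\<Sum>i<m. a i z * \<beta> i z)"
definition "\<rho> z = (\<Sum>i<m. scalar (v i z) * a i z)"

lemma Delbar_Del: "z \<in> S \<Longrightarrow> smooth_form S W \<Longrightarrow> Delbar (Del W) z = - Del (Delbar W) z"
  by (rule form_deriv_anticommute) (auto intro: form_type_anticommute[OF form_type_dz form_type_dzbar])

lemma smooth_exp: "smooth_on S (\<lambda>z. exp (- s z))"
  using smooth_on_mult[OF open_S smooth_on_const[of S "-1"] smooth_s]
  by (auto intro: smooth_on_exp[OF open_S])

lemma smooth_v: "i < m \<Longrightarrow> smooth_on S (v i)"
  unfolding v_def[abs_def] by (rule smooth_on_bounded_linear[OF open_S bounded_linear_cnj smooth_F])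

lemma smooth_forms [intro]:
  "i < m \<Longrightarrow> smooth_form S (\<alpha> i)" "i < m \<Longrightarrow> smooth_form S (\<beta> i)" "i < m \<Longrightarrow> smooth_form S (\<gamma> i)"
  "smooth_form S \<eta>" "i < m \<Longrightarrow> smooth_form S (a i)" "i < m \<Longrightarrow> smooth_form S (R i)"
  "i < m \<Longrightarrow> smooth_form S (C i)" "smooth_form S U" "smooth_form S \<rho>"
proof -
  show 1: "smooth_form S (\<alpha> i)" "smooth_form S (\<beta> i)" "smooth_form S (\<gamma> i)" if "i < m" for i
    using that smooth_F smooth_v unfolding \<alpha>_def \<beta>_def \<gamma>_def
    by (auto intro!: smooth_form_form_deriv smooth_form_scalar)
  show 2: "smooth_form S \<eta>"
    using smooth_s unfolding \<eta>_def by (auto intro!: smooth_form_form_deriv smooth_form_scalar)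
  show 3: "smooth_form S (a i)" if "i < m" for i
    unfolding a_def[abs_def] using 1[OF that] smooth_exp by (intro smooth_form_mult smooth_form_scalar)
  show "smooth_form S (R i)" "smooth_form S (C i)" if "i < m" for i
    unfolding R_def C_def[abs_def] using 1[OF that] 2 3[OF that]
    by (intro smooth_form_form_deriv smooth_form_mult smooth_form_diff; simp)+
  show "smooth_form S U" "smooth_form S \<rho>"
    unfolding U_def[abs_def] \<rho>_def[abs_def] using 1 3 smooth_v
    by (intro smooth_form_sum smooth_form_mult smooth_form_scalar; simp)+
qed

lemma types:
  assumes "z \<in> S"
  shows "form_type 1 0 (\<alpha> i z)" "form_type 0 1 (\<beta> i z)" "form_type 1 0 (\<gamma> i z)" "form_type 1 0 (\<eta> z)"
    "form_type 1 0 (a i z)" "form_type 1 1 (R i z)" "form_type 1 1 (C i z)" "form_type 1 1 (U z)"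
    "form_type 1 1 (Delbar \<eta> z)" "form_type 1 0 (\<rho> z)"
proof -
  have 1: "form_type 1 0 (\<alpha> i z)" "form_type 0 1 (\<beta> i z)" "form_type 1 0 (\<gamma> i z)" "form_type 1 0 (\<eta> z)"
    if "z \<in> S" for z i
    unfolding \<alpha>_def \<beta>_def \<gamma>_def \<eta>_def
    using P.form_type_D[OF that, of 0 0] Q.form_type_D[OF that, of 0 0] by simp_all
  have 2: "form_type 1 0 (a i z)" if "z \<in> S" for z i
    unfolding a_def by (intro form_type_scalar_mult 1 that)
  show "form_type 1 0 (\<alpha> i z)" "form_type 0 1 (\<beta> i z)" "form_type 1 0 (\<gamma> i z)" "form_type 1 0 (\<eta> z)"
    "form_type 1 0 (a i z)"
    by (intro 1 2 assms)+
  show "form_type 1 1 (R i z)" "form_type 1 1 (Delbar \<eta> z)"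
    unfolding R_def using Q.form_type_D[OF assms, of 1 0] 1 2 by simp_all
  show "form_type 1 1 (C i z)"
    unfolding C_def
    using Q.form_type_D[OF assms, of 1 0 "\<gamma> i"] form_type_mult[OF 1(2,4), of z z i] 1 assms
    by (intro form_type_diff) simp_all
  show "form_type 1 1 (U z)"
    unfolding U_def using form_type_mult[OF 2 1(2), of z z] assms by (intro form_type_sum) simp
  show "form_type 1 0 (\<rho> z)"
    unfolding \<rho>_def by (intro form_type_sum form_type_scalar_mult 2 assms)
qed

lemma evens:
  assumes "z \<in> S"
  shows "even_form (R i z)" "even_form (C i z)" "even_form (U z)" "even_form (Delbar \<eta> z)"
    "even_form (a i z * \<beta> j z)"
  using form_type_even_form[OF types(6)[OF assms]] form_type_even_form[OF types(7)[OF assms]]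
    form_type_even_form[OF types(8)[OF assms]] form_type_even_form[OF types(9)[OF assms]]
    form_type_even_form[OF form_type_mult[OF types(5)[OF assms] types(2)[OF assms]]] by auto

lemma anti:
  assumes "z \<in> S"
  shows "\<beta> i z * a j z = - (a j z * \<beta> i z)" "\<eta> z * \<alpha> i z = - (\<alpha> i z * \<eta> z)" "\<eta> z * \<beta> i z = - (\<beta> i z * \<eta> z)"
    "\<beta> i z * \<beta> j z = - (\<beta> j z * \<beta> i z)" "a i z * a j z = - (a j z * a i z)"
  by (rule form_type_anticommute[OF types(5,2)[OF assms]] form_type_anticommute[OF types(1,4)[OF assms]]
      form_type_anticommute[OF types(2,4)[OF assms]] form_type_anticommute[OF types(2,2)[OF assms]]
      form_type_anticommute[OF types(5,5)[OF assms]]; simp)+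

text \<open>Since \<partial> squares to zero, only the factor exp (- s) is differentiated. It
  contributes - \<eta> on the left of \<open>a i\<close>, and moving \<eta> to the right changes the
  sign.\<close>

lemma Del_a:
  assumes "z \<in> S" "i < m"
  shows "Del (a i) z = a i z * \<eta> z"
proof -
  have sm: "smooth_on S (\<lambda>z. - s z)"
    using smooth_on_mult[OF open_S smooth_on_const[of S "-1"] smooth_s] by simp
  have "Del (a i) z = Del (\<lambda>z. scalar (exp (- s z))) z * \<alpha> i z + scalar (exp (- s z)) * Del (\<alpha> i) z"
    unfolding a_def[abs_def] using assms smooth_exp by (intro P.D_scalar_mult) auto
  also have "Del (\<alpha> i) z = 0"
    unfolding \<alpha>_def using assms smooth_F by (intro P.D_D) auto
  also have "Del (\<lambda>z. scalar (exp (- s z))) z = - (scalar (exp (- s z)) * \<eta> z)"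
    using P.D_exp[OF assms(1) sm] P.D_uminus[OF assms(1) smooth_form_scalar[OF smooth_s]]
    by (simp add: scalar_uminus \<eta>_def)
  also have "- (scalar (exp (- s z)) * \<eta> z) * \<alpha> i z + scalar (exp (- s z)) * 0 = a i z * \<eta> z"
    by (simp add: a_def mult.assoc anti[OF assms(1)])
  finally show ?thesis .
qed

text \<open>The two terms of the product rule are - a \<beta> \<eta> and a \<open>Delbar\<close>
  \<gamma>, because \<open>Del\<close> \<beta> = - \<open>Delbar\<close> \<gamma>. Together they are
  a C, which accounts for the correction by \<eta> in the definition of \<open>C\<close>.\<close>

lemma Del_U:
  assumes "z \<in> S"
  shows "Del U z = (\<Sum>i<m. a i z * C i z)"
proof -
  have "Del U z = (\<Sum>i<m. Del (\<lambda>z. a i z * \<beta> i z) z)"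
    unfolding U_def[abs_def] using assms by (intro P.D_sum) auto
  also have "\<dots> = (\<Sum>i<m. a i z * C i z)"
  proof (rule sum.cong)
    fix i assume "i \<in> {..<m}"
    then have i: "i < m" by simp
    have "Del (\<lambda>z. a i z * \<beta> i z) z = Del (a i) z * \<beta> i z - a i z * Del (\<beta> i) z"
      using assms i types(5)[OF assms] by (intro P.D_mult_odd) auto
    moreover have "Del (\<beta> i) z = - Delbar (\<gamma> i) z"
      unfolding \<gamma>_def \<beta>_def using assms i smooth_v by (subst Delbar_Del) auto
    ultimately show "Del (\<lambda>z. a i z * \<beta> i z) z = a i z * C i z"
      by (simp add: Del_a assms i C_def mult.assoc anti[OF assms] right_diff_distrib)
  qed simp
  finally show ?thesis .
qed

lemma Delbar_U:
  assumes "z \<in> S"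
  shows "Delbar U z = (\<Sum>i<m. R i z * \<beta> i z)"
proof -
  have "Delbar U z = (\<Sum>i<m. Delbar (\<lambda>z. a i z * \<beta> i z) z)"
    unfolding U_def[abs_def] using assms by (intro Q.D_sum) auto
  also have "\<dots> = (\<Sum>i<m. R i z * \<beta> i z)"
  proof (rule sum.cong)
    fix i assume "i \<in> {..<m}"
    then have i: "i < m" by simp
    have "Delbar (\<lambda>z. a i z * \<beta> i z) z = Delbar (a i) z * \<beta> i z - a i z * Delbar (\<beta> i) z"
      using assms i types(5)[OF assms] by (intro Q.D_mult_odd) auto
    moreover have "Delbar (\<beta> i) z = 0"
      unfolding \<beta>_def using assms i smooth_v by (intro Q.D_D) auto
    ultimately show "Delbar (\<lambda>z. a i z * \<beta> i z) z = R i z * \<beta> i z"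
      by (simp add: R_def)
  qed simp
  finally show ?thesis .
qed

text \<open>Only the product \<beta> \<eta> survives, and \<beta> is closed under
  \<open>Delbar\<close>. Multiplied by \<open>a i\<close> and summed, this becomes the term with
  \<open>U z\<close> in \<open>Delbar_Del_U\<close>.\<close>

lemma Delbar_C:
  assumes "z \<in> S" "i < m"
  shows "Delbar (C i) z = \<beta> i z * Delbar \<eta> z"
proof -
  have "Delbar (C i) z = Delbar (Delbar (\<gamma> i)) z - Delbar (\<lambda>z. \<beta> i z * \<eta> z) z"
    unfolding C_def[abs_def] using assms by (intro Q.D_diff) auto
  also have "Delbar (Delbar (\<gamma> i)) z = 0"
    using assms by (intro Q.D_D) auto
  also have "Delbar (\<lambda>z. \<beta> i z * \<eta> z) z = Delbar (\<beta> i) z * \<eta> z - \<beta> i z * Delbar \<eta> z"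
    using assms types(2)[OF assms(1)] by (intro Q.D_mult_odd) auto
  also have "Delbar (\<beta> i) z = 0"
    unfolding \<beta>_def using assms smooth_v by (intro Q.D_D) auto
  finally show ?thesis by simp
qed

lemma Delbar_Del_U:
  assumes "z \<in> S"
  shows "Delbar (Del U) z = (\<Sum>i<m. R i z * C i z) - U z * Delbar \<eta> z"
proof -
  have "Delbar (Del U) z = Delbar (\<lambda>z. \<Sum>i<m. a i z * C i z) z"
    using assms by (rule form_deriv_cong) (rule Del_U)
  also have "\<dots> = (\<Sum>i<m. Delbar (\<lambda>z. a i z * C i z) z)"
    using assms by (intro Q.D_sum) auto
  also have "\<dots> = (\<Sum>i<m. R i z * C i z - a i z * \<beta> i z * Delbar \<eta> z)"
  proof (rule sum.cong)
    fix i assume "i \<in> {..<m}"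
    then have i: "i < m" by simp
    have "Delbar (\<lambda>z. a i z * C i z) z = Delbar (a i) z * C i z - a i z * Delbar (C i) z"
      using assms i types(5)[OF assms] by (intro Q.D_mult_odd) auto
    then show "Delbar (\<lambda>z. a i z * C i z) z = R i z * C i z - a i z * \<beta> i z * Delbar \<eta> z"
      by (simp add: R_def Delbar_C assms i mult.assoc)
  qed simp
  finally show ?thesis
    by (simp add: sum_subtractf U_def sum_distrib_right)
qed

text \<open>The term - U arises from exchanging the odd factors in \<beta> a. It is the origin of -
  U in the last entry of the curvature.\<close>

lemma Delbar_\<rho>:
  assumes "z \<in> S"
  shows "Delbar \<rho> z = (\<Sum>i<m. R i z * scalar (v i z)) - U z"
proof -
  have "Delbar \<rho> z = (\<Sum>i<m. Delbar (\<lambda>z. scalar (v i z) * a i z) z)"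
    unfolding \<rho>_def[abs_def] using assms smooth_v
    by (intro Q.D_sum) (auto intro!: smooth_form_mult smooth_form_scalar smooth_forms(5))
  also have "\<dots> = (\<Sum>i<m. R i z * scalar (v i z) - a i z * \<beta> i z)"
  proof (rule sum.cong)
    fix i assume "i \<in> {..<m}"
    then have i: "i < m" by simp
    have "Delbar (\<lambda>z. scalar (v i z) * a i z) z = \<beta> i z * a i z + scalar (v i z) * Delbar (a i) z"
      unfolding \<beta>_def using assms i smooth_v by (intro Q.D_scalar_mult) auto
    then show "Delbar (\<lambda>z. scalar (v i z) * a i z) z = R i z * scalar (v i z) - a i z * \<beta> i z"
      by (simp add: R_def anti[OF assms] scalar_commute)
  qed simp
  finally show ?thesis
    by (simp add: sum_subtractf U_def)
qed

end

text \<open>The entries of the metric at a point, where \<open>u i\<close> is the value of the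
  function with index i + 1 and \<open>w\<close> is the exponential of \<sigma>;
  \<open>h_mat_eq\<close> confirms this.\<close>

definition metric_entry :: "nat \<Rightarrow> (nat \<Rightarrow> complex) \<Rightarrow> complex \<Rightarrow> nat \<Rightarrow> nat \<Rightarrow> complex" where
  "metric_entry m u w i j =
     (if i < m then if j < m then if i = j then 1 else 0 else cnj (u i)
      else if j < m then u j else (\<Sum>k<m. u k * cnj (u k)) + w)"

text \<open>Block inversion with \<open>w'\<close> in the role of 1 / w: the Schur complement of the
  identity block of the metric is \<open>w\<close>.\<close>

definition inverse_metric_entry :: "nat \<Rightarrow> (nat \<Rightarrow> complex) \<Rightarrow> complex \<Rightarrow> nat \<Rightarrow> nat \<Rightarrow> complex" where
  "inverse_metric_entry m u w' i j =
     (if i < m then if j < m then (if i = j then 1 else 0) + w' * cnj (u i) * u j else - (w' * cnj (u i))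
      else if j < m then - (w' * u j) else w')"

section \<open>The derivatives of the logarithm, the connection and the curvature in a chart\<close>

context bundle_chart
begin

lemma even_U: "z \<in> S \<Longrightarrow> even_form (scalar c * U z)"
  by (rule form_type_even_form[OF form_type_scalar_mult[OF types(8)]]) auto

text \<open>With G the reciprocal of 1 - y, the truncated series gives \<open>Del\<close> log (1 -
  y) = - G \<open>Del\<close> y, and \<open>Delbar\<close> of G is G G \<open>Delbar\<close> y. The
  derivatives of \<open>y\<close> are odd, so their order in the result matters.\<close>

lemma Delbar_Del_log:
  fixes c :: complex
  defines "L \<equiv> \<lambda>z. log_one_minus (scalar c * U z)"
    and "y \<equiv> \<lambda>z. scalar c * U z"
  assumes z: "z \<in> S" and N: "N > CARD('n)" and G: "G = (\<Sum>j<N. y z ^ j)"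
  shows "Delbar (Del L) z = - (G * (G * (Delbar y z * Del y z)) + G * Delbar (Del y) z)"
proof -
  let ?G = "\<lambda>z. \<Sum>j<N. y z ^ j"
  have sy [intro]: "smooth_form S y" unfolding y_def by auto
  have ty: "form_type 1 1 (y z)" if "z \<in> S" for z
    unfolding y_def by (intro form_type_scalar_mult types that)
  have ey: "even_form (y z)" if "z \<in> S" for z
    using form_type_even_form[OF ty[OF that]] by simp
  have eG: "even_form (?G z)" if "z \<in> S" for z
    by (intro even_form_sum even_form_power ey that)
  have geo: "?G z * (1 - y z) = 1" if "z \<in> S" for z
    by (rule geometric_sum_nilpotent[OF ty[OF that] N])
  have sG [intro]: "smooth_form S ?G"
    by (intro smooth_form_sum[of "{..<N}" "\<lambda>j z. y z ^ j"] smooth_form_power sy)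
  have "Del L z = - (?G z * Del y z)" if z: "z \<in> S" for z
  proof -
    let ?L = "\<lambda>z. \<Sum>j<N. scalar (1 / of_nat (Suc j)) * y z ^ Suc j"
    have "Del L z = Del (\<lambda>z. - ?L z) z"
      using z unfolding L_def
      by (rule form_deriv_cong) (use log_one_minus_eq[OF ty N] in \<open>simp add: y_def\<close>)
    also have "\<dots> = - Del ?L z"
      using z by (intro P.D_uminus smooth_form_sum smooth_form_mult smooth_form_power sy) auto
    also have "Del ?L z = (\<Sum>j<N. Del (\<lambda>z. scalar (1 / of_nat (Suc j)) * y z ^ Suc j) z)"
      using z by (intro P.D_sum smooth_form_mult smooth_form_power sy) auto
    also have "\<dots> = (\<Sum>j<N. y z ^ j * Del y z)"
    proof (rule sum.cong)
      fix j
      have "Del (\<lambda>z. scalar (1 / of_nat (Suc j)) * y z ^ Suc j) z =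
          scalar (1 / of_nat (Suc j)) * Del (\<lambda>z. y z ^ Suc j) z"
        using z by (intro P.D_cmult smooth_form_power sy)
      also have "Del (\<lambda>z. y z ^ Suc j) z = scalar (of_nat (Suc j)) * (y z ^ j * Del y z)"
        using z ey by (intro P.D_power sy)
      finally show "Del (\<lambda>z. scalar (1 / of_nat (Suc j)) * y z ^ Suc j) z = y z ^ j * Del y z"
        by (simp add: scalar_mult[symmetric] del: of_nat_Suc flip: mult.assoc)
    qed simp
    finally show ?thesis by (simp add: sum_distrib_right)
  qed
  then have "Delbar (Del L) z = Delbar (\<lambda>z. - (?G z * Del y z)) z"
    by (rule form_deriv_cong[OF z])
  also have "\<dots> = - Delbar (\<lambda>z. ?G z * Del y z) z"
    using z by (intro Q.D_uminus smooth_form_mult sG smooth_form_form_deriv sy)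
  also have "Delbar (\<lambda>z. ?G z * Del y z) z = Delbar ?G z * Del y z + G * Delbar (Del y) z"
    unfolding G using z by (intro Q.D_mult_even eG sG smooth_form_form_deriv sy)
  also have "Delbar ?G z = G * (G * Delbar y z)"
  proof (rule even_form_cancel[where a = "y z"])
    show "G * (1 - y z) = 1" "even_form (y z)" "even_form G"
      using geo[OF z] ey[OF z] eG[OF z] by (simp_all add: G)
    \<comment> \<open>The identity G (1 - y) = 1 holds on all of \<open>S\<close> and may be
      differentiated; solving for the derivative of G avoids the individual powers.\<close>
    have "Delbar (\<lambda>z. ?G z * (1 - y z)) z = Delbar (\<lambda>z. 1) z"
      using z by (rule form_deriv_cong) (rule geo)
    moreover have "Delbar (\<lambda>z. ?G z * (1 - y z)) z = Delbar ?G z * (1 - y z) + G * Delbar (\<lambda>z. 1 - y z) z"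
      unfolding G using z by (intro Q.D_mult_even eG sG smooth_form_diff smooth_form_const sy)
    moreover have "Delbar (\<lambda>z. 1 - y z) z = - Delbar y z"
      using z by (subst Q.D_diff) auto
    ultimately show "Delbar ?G z * (1 - y z) = G * Delbar y z"
      by simp
  qed
  finally show ?thesis by (simp add: mult.assoc)
qed

text \<open>The connection matrix in closed form: the column (- v, 1) times the row (a, \<rho> +
  \<eta>), plus \<gamma> in the last column. The unipotent matrix with last column v sends (- v, 1)
  to the last basis vector, which is why conjugating by it simplifies the curvature.\<close>

definition "conn i j z =
  (if j < m then if i < m then - (scalar (v i z) * a j z) else a j z
   else if i < m then \<gamma> i z - scalar (v i z) * (\<rho> z + \<eta> z) else \<rho> z + \<eta> z)"

text \<open>Only the last row and the last column of the metric vary, so in the first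
  \<open>m\<close> columns a single summand remains.\<close>

lemma inverse_metric_times_Del_metric:
  assumes z: "z \<in> S" and ij: "i \<le> m" "j \<le> m"
  shows "(\<Sum>k<Suc m. scalar (inverse_metric_entry m (\<lambda>i. F i z) (exp (- s z)) i k) *
      Del (\<lambda>z. scalar (metric_entry m (\<lambda>i. F i z) (exp (s z)) k j)) z) = conn i j z"
proof -
  let ?w = "scalar (exp (- s z))"
  let ?M = "\<lambda>k j. Del (\<lambda>z. scalar (metric_entry m (\<lambda>i. F i z) (exp (s z)) k j)) z"
  have e: "exp (- s z) * exp (s z) = 1" by (simp flip: exp_add)
  have M1: "?M k j = 0" if "k < m" "j < m" for k j
    using that by (simp add: metric_entry_def)
  have M2: "?M k m = \<gamma> k z" if "k < m" for k
    using that by (simp add: metric_entry_def \<gamma>_def v_def)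
  have M3: "?M m j = \<alpha> j z" if "j < m" for j
    using that by (simp add: metric_entry_def \<alpha>_def)
  have M4: "?M m m = (\<Sum>k<m. \<alpha> k z * scalar (v k z) + scalar (F k z) * \<gamma> k z) + scalar (exp (s z)) * \<eta> z"
  proof -
    have "?M m m = Del (\<lambda>z. (\<Sum>k<m. scalar (F k z) * scalar (v k z)) + scalar (exp (s z))) z"
      by (simp add: metric_entry_def v_def scalar_add scalar_sum scalar_mult)
    also have "\<dots> = Del (\<lambda>z. \<Sum>k<m. scalar (F k z) * scalar (v k z)) z + Del (\<lambda>z. scalar (exp (s z))) z"
      using smooth_F smooth_v smooth_s open_S z
      by (intro P.D_add smooth_form_sum smooth_form_mult smooth_form_scalar smooth_on_exp) auto
    also have "Del (\<lambda>z. scalar (exp (s z))) z = scalar (exp (s z)) * \<eta> z"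
      unfolding \<eta>_def using z smooth_s by (rule P.D_exp)
    also have "Del (\<lambda>z. \<Sum>k<m. scalar (F k z) * scalar (v k z)) z =
        (\<Sum>k<m. Del (\<lambda>z. scalar (F k z) * scalar (v k z)) z)"
      using smooth_F smooth_v z
      by (intro P.D_sum smooth_form_mult smooth_form_scalar) auto
    also have "\<dots> = (\<Sum>k<m. \<alpha> k z * scalar (v k z) + scalar (F k z) * \<gamma> k z)"
      unfolding \<alpha>_def \<gamma>_def using smooth_F smooth_v z
      by (intro sum.cong P.D_scalar_mult smooth_form_scalar) auto
    finally show ?thesis .
  qed
  have rho: "\<rho> z = ?w * (\<Sum>k<m. \<alpha> k z * scalar (v k z))"
    unfolding \<rho>_def sum_distrib_left
    by (rule sum.cong) (auto simp: a_def scalar_commute[of "\<alpha> _ z"]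
        scalar_left_commute[of "scalar (v _ z)" "exp (- s z)"])
  \<comment> \<open>The middle term cancels against the entries k < m of the last column, in the row
    \<open>m\<close> as well as in the rows above it.\<close>
  have Mmm: "?w * ?M m m = \<rho> z + ?w * (\<Sum>k<m. scalar (F k z) * \<gamma> k z) + \<eta> z"
    unfolding M4 rho by (simp add: distrib_left sum.distrib e flip: mult.assoc scalar_mult)
  show ?thesis
  proof (cases "j < m")
    case True
    then have "(\<Sum>k<Suc m. scalar (inverse_metric_entry m (\<lambda>i. F i z) (exp (- s z)) i k) * ?M k j) =
        scalar (inverse_metric_entry m (\<lambda>i. F i z) (exp (- s z)) i m) * \<alpha> j z"
      by (simp add: M1 M3)
    then show ?thesis
      using True by (simp add: inverse_metric_entry_def conn_def a_def v_def scalar_uminus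
          mult.commute[of "exp (- s z)"] flip: mult.assoc scalar_mult)
  next
    case False
    then have j: "j = m" using ij by simp
    show ?thesis
    proof (cases "i < m")
      case True
      have comm: "cnj (F i z) * exp (- s z) * F k z = cnj (F i z) * F k z * exp (- s z)" for k
        by (simp add: mult_ac)
      have "(\<Sum>k<m. scalar (inverse_metric_entry m (\<lambda>i. F i z) (exp (- s z)) i k) * ?M k m) =
          (\<Sum>k<m. (if i = k then \<gamma> i z else 0) + scalar (v i z) * (?w * (scalar (F k z) * \<gamma> k z)))"
        by (rule sum.cong) (use True in \<open>auto simp: M2 inverse_metric_entry_def scalar_add v_def distrib_right
            mult.commute[of "exp (- s z)"] comm simp flip: mult.assoc scalar_mult\<close>)
      also have "\<dots> = \<gamma> i z + scalar (v i z) * (?w * (\<Sum>k<m. scalar (F k z) * \<gamma> k z))"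
        using True by (simp add: sum.distrib sum_distrib_left)
      finally have "(\<Sum>k<Suc m. scalar (inverse_metric_entry m (\<lambda>i. F i z) (exp (- s z)) i k) * ?M k m) =
          \<gamma> i z + scalar (v i z) * (?w * (\<Sum>k<m. scalar (F k z) * \<gamma> k z)) - scalar (v i z) * (?w * ?M m m)"
        using True by (simp add: inverse_metric_entry_def v_def scalar_uminus
            mult.commute[of "exp (- s z)"] flip: mult.assoc scalar_mult)
      then show ?thesis
        using True unfolding Mmm j by (simp add: conn_def distrib_left)
    next
      case False
      then have i: "i = m" using ij by simp
      have "(\<Sum>k<m. scalar (inverse_metric_entry m (\<lambda>i. F i z) (exp (- s z)) m k) * ?M k m) =
          - (?w * (\<Sum>k<m. scalar (F k z) * \<gamma> k z))"
        by (simp add: M2 inverse_metric_entry_def scalar_uminus scalar_mult sum_distrib_left sum_negf mult.assoc)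
      then have "(\<Sum>k<Suc m. scalar (inverse_metric_entry m (\<lambda>i. F i z) (exp (- s z)) m k) * ?M k m) =
          - (?w * (\<Sum>k<m. scalar (F k z) * \<gamma> k z)) + ?w * ?M m m"
        by (simp add: inverse_metric_entry_def)
      then show ?thesis
        unfolding Mmm i j by (simp add: conn_def)
    qed
  qed
qed

lemma smooth_conn: "i \<le> m \<Longrightarrow> j \<le> m \<Longrightarrow> smooth_form S (conn i j)"
proof -
  assume "i \<le> m" "j \<le> m"
  then have "j < m \<or> j = m" "i < m \<or> i = m" by auto
  then show ?thesis
    unfolding conn_def[abs_def]
    by (auto intro!: smooth_form_uminus smooth_form_mult smooth_form_scalar smooth_v smooth_forms
        smooth_form_diff smooth_form_add)
qed

lemma form_type_conn: "z \<in> S \<Longrightarrow> form_type 1 0 (conn i j z)"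
  unfolding conn_def
  by (auto intro!: form_type_uminus form_type_diff form_type_add form_type_scalar_mult types simp del: One_nat_def)

text \<open>The entries have the shape demanded of \<open>B\<close> in
  \<open>det_bordered_antisymmetric\<close>. For this reason those of the last column are expressed
  through the last diagonal entry.\<close>

lemma curvature_entries:
  assumes z: "z \<in> S"
  shows "i < m \<Longrightarrow> j < m \<Longrightarrow> Delbar (conn i j) z = a j z * \<beta> i z - scalar (v i z) * R j z"
    and "j < m \<Longrightarrow> Delbar (conn m j) z = R j z"
    and "Delbar (conn m m) z = (\<Sum>j<m. R j z * scalar (v j z)) - U z + Delbar \<eta> z"
    and "i < m \<Longrightarrow> Delbar (conn i m) z =
      C i z + (\<Sum>j<m. a j z * \<beta> i z * scalar (v j z)) - scalar (v i z) * Delbar (conn m m) z"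
proof -
  have conn: "conn m m = (\<lambda>z. \<rho> z + \<eta> z)" by (simp add: conn_def fun_eq_iff)
  show 3: "Delbar (conn m m) z = (\<Sum>j<m. R j z * scalar (v j z)) - U z + Delbar \<eta> z"
    unfolding conn using z by (subst Q.D_add) (auto simp: Delbar_\<rho>)
  show "Delbar (conn m j) z = R j z" if "j < m"
  proof -
    have "conn m j = a j" using that by (simp add: conn_def fun_eq_iff)
    then show ?thesis by (simp add: R_def)
  qed
  show "Delbar (conn i j) z = a j z * \<beta> i z - scalar (v i z) * R j z" if "i < m" "j < m"
  proof -
    have "conn i j = (\<lambda>z. - (scalar (v i z) * a j z))" using that by (simp add: conn_def fun_eq_iff)
    then have "Delbar (conn i j) z = - Delbar (\<lambda>z. scalar (v i z) * a j z) z"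
      using z that smooth_v
      by (simp only:) (intro Q.D_uminus smooth_form_mult smooth_form_scalar smooth_forms)
    also have "Delbar (\<lambda>z. scalar (v i z) * a j z) z = \<beta> i z * a j z + scalar (v i z) * R j z"
      unfolding R_def \<beta>_def using z that smooth_v by (intro Q.D_scalar_mult smooth_forms)
    finally show ?thesis by (simp add: anti[OF z])
  qed
  show "Delbar (conn i m) z =
      C i z + (\<Sum>j<m. a j z * \<beta> i z * scalar (v j z)) - scalar (v i z) * Delbar (conn m m) z" if i: "i < m"
  proof -
    have "conn i m = (\<lambda>z. \<gamma> i z - scalar (v i z) * conn m m z)"
      using i by (simp add: conn_def fun_eq_iff)
    then have "Delbar (conn i m) z = Delbar (\<gamma> i) z - Delbar (\<lambda>z. scalar (v i z) * conn m m z) z"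
      using z i smooth_v
      by (simp only:) (intro Q.D_diff smooth_form_mult smooth_form_scalar smooth_forms smooth_conn; simp)
    also have "Delbar (\<lambda>z. scalar (v i z) * conn m m z) z =
        \<beta> i z * conn m m z + scalar (v i z) * Delbar (conn m m) z"
      unfolding \<beta>_def using z i smooth_v by (intro Q.D_scalar_mult smooth_conn) auto
    also have "\<beta> i z * conn m m z = \<beta> i z * \<rho> z + \<beta> i z * \<eta> z"
      unfolding conn by (rule distrib_left)
    also have "\<beta> i z * \<rho> z = - (\<Sum>j<m. a j z * \<beta> i z * scalar (v j z))"
      unfolding \<rho>_def sum_distrib_left sum_negf[symmetric]
      by (rule sum.cong) (simp_all add: anti[OF z] scalar_left_commute[of "\<beta> i z"]
          scalar_commute[of "a _ z * \<beta> i z"])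
    finally show ?thesis by (simp add: C_def)
  qed
qed

section \<open>Chern forms\<close>

lemma total_chern_chart:
  assumes z: "z \<in> S"
  shows "form_det (Matrix.mat (Suc m) (Suc m)
      (\<lambda>(i, j). (if i = j then 1 else 0) + scalar c * Delbar (conn i j) z)) =
    1 + scalar c * Delbar \<eta> z + scalar c * Delbar (Del (\<lambda>z. log_one_minus (scalar c * U z))) z"
    (is "form_det ?B = _")
proof -
  let ?k = "scalar c :: 'n cform"
  define N where "N = Suc CARD('n)"
  define G where "G = (\<Sum>j<N. (?k * U z) ^ j)"
  \<comment> \<open>The corner of the bordered matrix after conjugation: the sum with
    \<open>R\<close> and \<open>v\<close> in the last diagonal entry is removed by it.\<close>
  define E where "E = 1 + ?k * (Delbar \<eta> z - U z)"
  have geo: "G * (1 - ?k * U z) = 1"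
    unfolding G_def
    by (rule geometric_sum_nilpotent) (auto intro!: form_type_scalar_mult types z simp: N_def simp del: One_nat_def)
  have ek: "even_form ?k" using form_type_even_form[OF form_type_scalar] by simp
  have even: "even_form (?k * R i z)" "even_form (?k * C i z)" "even_form (?k * (a j z * \<beta> i z))"
    "even_form (scalar (v i z) :: 'n cform)" "even_form E" "even_form G"
    "even_form ((if i = j then 1 else 0) + ?k * Delbar (conn i j) z)" for i j
  proof -
    show "even_form (?k * R i z)" "even_form (?k * C i z)" "even_form (?k * (a j z * \<beta> i z))"
      by (intro even_form_mult ek evens z)+
    show "even_form (scalar (v i z) :: 'n cform)"
      using form_type_even_form[OF form_type_scalar] by simp
    show "even_form E"
      unfolding E_def by (intro even_form_add even_form_one even_form_mult even_form_diff ek evens z)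
    show "even_form G"
      unfolding G_def by (intro even_form_sum even_form_power even_U z)
    have "even_form (Delbar (conn i j) z)"
      using Q.form_type_D[OF z, of 1 0 "conn i j"] form_type_conn form_type_even_form by fastforce
    then show "even_form ((if i = j then 1 else 0) + ?k * Delbar (conn i j) z)"
      by (intro even_form_add even_form_mult ek) (simp_all add: even_form_one even_form_zero)
  qed
  have ab: "\<beta> i z * (a j z * X) = - (a j z * (\<beta> i z * X))" for i j X
    by (simp add: anti(1)[OF z] flip: mult.assoc)
  note Abs_inv = Abs_even_cform_inverse[unfolded mem_Collect_eq]
  \<comment> \<open>From here on the entries live in the ring of even forms; equations there are
    checked by mapping them back with \<open>Rep_even_cform\<close>.\<close>
  define B where "B i j = Abs_even_cform ((if i = j then 1 else 0) + ?k * Delbar (conn i j) z)" for i j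
  define x where "x i j = Abs_even_cform (?k * (a j z * \<beta> i z))" for i j
  define R' where "R' i = Abs_even_cform (?k * R i z)" for i
  define C' where "C' i = Abs_even_cform (?k * C i z)" for i
  define V where "V i = Abs_even_cform (scalar (v i z) :: 'n cform)" for i
  define e where "e = Abs_even_cform E"
  define q where "q = Abs_even_cform G"
  have Rep [simp]: "Rep_even_cform (B i j) = (if i = j then 1 else 0) + ?k * Delbar (conn i j) z"
    "Rep_even_cform (x i j) = ?k * (a j z * \<beta> i z)" "Rep_even_cform (R' i) = ?k * R i z"
    "Rep_even_cform (C' i) = ?k * C i z" "Rep_even_cform (V i) = scalar (v i z)"
    "Rep_even_cform e = E" "Rep_even_cform q = G" for i j
    unfolding B_def x_def R'_def C'_def V_def e_def q_def by (simp_all only: Abs_inv even)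
  note rep_simps = plus_even_cform.rep_eq times_even_cform.rep_eq minus_even_cform.rep_eq
    uminus_even_cform.rep_eq one_even_cform.rep_eq zero_even_cform.rep_eq Rep_even_cform_sum
  have "?B = map_mat Rep_even_cform (Matrix.mat (Suc m) (Suc m) (\<lambda>(i, j). B i j))"
    by (rule eq_matI) auto
  then have "form_det ?B = Rep_even_cform (Determinant.det (Matrix.mat (Suc m) (Suc m) (\<lambda>(i, j). B i j)))"
    by (simp only: form_det_even[OF mat_carrier])
  also have "Determinant.det (Matrix.mat (Suc m) (Suc m) (\<lambda>(i, j). B i j)) =
      q * (e - (\<Sum>i<m. R' i * C' i) + q * (\<Sum>i<m. \<Sum>j<m. R' i * x i j * C' j))"
  proof (rule det_bordered_antisymmetric)
    have k2: "(?k * X) * (?k * Y) = ?k * (?k * (X * Y))" for X Y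
      by (simp add: scalar_left_commute[of X] mult.assoc)
    show "x i j * x k l = - (x i l * x k j)" for i j k l
    proof -
      \<comment> \<open>Both products are brought into the order a a \<beta> \<beta>. The \<beta>
        factors then agree, and the \<open>a\<close> factors differ by one transposition.\<close>
      have "a j z * \<beta> i z * (a l z * \<beta> k z) = - (a j z * a l z * (\<beta> i z * \<beta> k z))"
        by (simp add: mult.assoc ab)
      moreover have "a l z * \<beta> i z * (a j z * \<beta> k z) = - (a l z * a j z * (\<beta> i z * \<beta> k z))"
        by (simp add: mult.assoc ab)
      ultimately have "a j z * \<beta> i z * (a l z * \<beta> k z) = - (a l z * \<beta> i z * (a j z * \<beta> k z))"
        by (simp add: anti(5)[OF z, of j l])
      then show ?thesis
        by (simp add: Rep_even_cform_inject[symmetric] rep_simps k2)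
    qed
    show "x i j * x k j = 0" for i j k
    proof -
      have "a j z * a j z = 0"
        using form_type_square_zero[OF types(5)[OF z]] by simp
      then have "a j z * \<beta> i z * (a j z * \<beta> k z) = 0"
        by (simp add: mult.assoc ab) (simp flip: mult.assoc)
      then show ?thesis
        by (simp add: Rep_even_cform_inject[symmetric] rep_simps k2)
    qed
    show "B i j = (if i = j then 1 else 0) + x i j - V i * R' j" if "i < m" "j < m" for i j
      using that by (simp add: Rep_even_cform_inject[symmetric] rep_simps curvature_entries(1)[OF z]
          right_diff_distrib scalar_left_commute[of "scalar (v i z)"])
    show "B m j = R' j" if "j < m" for j
      using that by (simp add: Rep_even_cform_inject[symmetric] rep_simps curvature_entries(2)[OF z])
    show "B m m = e + (\<Sum>j<m. R' j * V j)"
      by (simp add: Rep_even_cform_inject[symmetric] rep_simps curvature_entries(3)[OF z] E_def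
          mult.assoc algebra_simps sum_distrib_left)
    show "B i m = V i + (\<Sum>j<m. x i j * V j) + C' i - V i * B m m" if i: "i < m" for i
      using i by (simp add: Rep_even_cform_inject[symmetric] rep_simps curvature_entries(4)[OF z i]
          mult.assoc distrib_left right_diff_distrib sum_distrib_left scalar_left_commute[of "scalar (v i z)"])
    show "q * (1 - (\<Sum>i<m. x i i)) = 1"
      using geo by (simp add: Rep_even_cform_inject[symmetric] rep_simps U_def sum_distrib_left)
  qed
  also have "Rep_even_cform \<dots> = G * (E - (\<Sum>i<m. ?k * R i z * (?k * C i z)) +
      G * (\<Sum>i<m. \<Sum>j<m. ?k * R i z * (?k * (a j z * \<beta> i z)) * (?k * C j z)))"
    by (simp add: rep_simps)
  also have "\<dots> = 1 + ?k * Delbar \<eta> z + ?k * Delbar (Del (\<lambda>z. log_one_minus (?k * U z))) z"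
  proof -
    define T where "T = (\<Sum>i<m. R i z * C i z)"
    have mv: "X * (?k * Y) = ?k * (X * Y)" for X Y by (rule scalar_left_commute)
    have RC: "(\<Sum>i<m. ?k * R i z * (?k * C i z)) = ?k * (?k * T)"
      by (simp add: T_def sum_distrib_left mult.assoc mv[of "R _ z"])
    \<comment> \<open>Exchanging \<open>a j\<close> and \<open>\<beta> i\<close> separates the
      indices, so the double sum factors into \<open>Delbar U\<close> times \<open>Del U\<close>,
      with a minus sign.\<close>
    have "R i z * (a j z * \<beta> i z * C j z) = - (R i z * \<beta> i z * (a j z * C j z))" for i j
      by (simp add: mult.assoc ab)
    then have RxC: "(\<Sum>i<m. \<Sum>j<m. ?k * R i z * (?k * (a j z * \<beta> i z)) * (?k * C j z)) =
        - (?k * (?k * (?k * (Delbar U z * Del U z))))"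
      unfolding Delbar_U[OF z] Del_U[OF z] sum_product
      by (simp add: sum_distrib_left sum_negf mult.assoc mv[of "R _ z"] mv[of "a _ z"] mv[of "\<beta> _ z"])
    have y: "Delbar (\<lambda>z. ?k * U z) z = ?k * Delbar U z" "Del (\<lambda>z. ?k * U z) z = ?k * Del U z"
      using z by (auto intro: Q.D_cmult P.D_cmult)
    have "Delbar (Del (\<lambda>z. ?k * U z)) z = Delbar (\<lambda>z. ?k * Del U z) z"
      using z by (rule form_deriv_cong) (auto intro: P.D_cmult)
    also have "\<dots> = ?k * Delbar (Del U) z"
      using z by (intro Q.D_cmult) auto
    also have "Delbar (Del U) z = T - U z * Delbar \<eta> z"
      unfolding T_def by (rule Delbar_Del_U[OF z])
    finally have yy: "Delbar (Del (\<lambda>z. ?k * U z)) z = ?k * (T - U z * Delbar \<eta> z)" .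
    \<comment> \<open>Writing G as 1 + c G U in front of \<open>Delbar \<eta>\<close> splits off the
      first Chern form of the line bundle; the remainder matches the term U
      \<open>Delbar \<eta>\<close> in \<open>Delbar (Del U)\<close>.\<close>
    have GU: "G - ?k * (G * U z) = 1"
      using geo by (simp add: right_diff_distrib mv[of G])
    have "?k * (G * Delbar \<eta> z) = ?k * ((G - ?k * (G * U z)) * Delbar \<eta> z) + ?k * (?k * (G * (U z * Delbar \<eta> z)))"
      by (simp add: algebra_simps)
    then have GD: "?k * (G * Delbar \<eta> z) = ?k * Delbar \<eta> z + ?k * (?k * (G * (U z * Delbar \<eta> z)))"
      by (simp add: GU)
    have "N > CARD('n)" by (simp add: N_def)
    from Delbar_Del_log[OF z this G_def]
    have log: "Delbar (Del (\<lambda>z. log_one_minus (?k * U z))) z =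
        - (?k * (?k * (G * (G * (Delbar U z * Del U z)))) + (?k * (G * T) - ?k * (G * (U z * Delbar \<eta> z))))"
      unfolding y yy by (simp add: mult.assoc mv[of G] mv[of "Delbar U z"] right_diff_distrib)
    have "G * (E - ?k * (?k * T) + G * - (?k * (?k * (?k * (Delbar U z * Del U z))))) =
        (G - ?k * (G * U z)) + ?k * (G * Delbar \<eta> z) - ?k * (?k * (G * T)) -
        ?k * (?k * (?k * (G * (G * (Delbar U z * Del U z)))))"
      by (simp add: E_def mv[of G] algebra_simps)
    then show ?thesis
      unfolding RC RxC GU GD log by (simp add: algebra_simps)
  qed
  finally show ?thesis .
qed

text \<open>The closed form \<open>Delbar_Del_log\<close> matches the determinant; this expansion
  into powers of \<open>U\<close> is what separates the bidegrees.\<close>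

lemma Delbar_Del_log_sum:
  assumes z: "z \<in> S" and N: "N > CARD('n)"
  shows "Delbar (Del (\<lambda>z. log_one_minus (scalar c * U z))) z =
    - (\<Sum>j<N. scalar (c ^ Suc j / of_nat (Suc j)) * Delbar (Del (\<lambda>z. U z ^ Suc j)) z)"
proof -
  let ?W = "\<lambda>j z. scalar (c ^ Suc j / of_nat (Suc j)) * U z ^ Suc j"
  have sW: "smooth_form S (?W j)" for j by (intro smooth_form_mult smooth_form_power smooth_form_const smooth_forms)
  have Del: "Del (\<lambda>z. log_one_minus (scalar c * U z)) z =
      - (\<Sum>j<N. scalar (c ^ Suc j / of_nat (Suc j)) * Del (\<lambda>z. U z ^ Suc j) z)" if z: "z \<in> S" for z
  proof -
    have "log_one_minus (scalar c * U y) = - (\<Sum>j<N. ?W j y)" if "y \<in> S" for y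
    proof -
      have "(scalar c * U y) ^ j = scalar (c ^ j) * U y ^ j" for j
        by (induction j) (simp_all add: scalar_mult mult.assoc scalar_left_commute[of "U y"])
      then have "scalar (1 / of_nat (Suc j)) * (scalar c * U y) ^ Suc j = ?W j y" for j
        by (simp only: mult.assoc[symmetric] scalar_mult[symmetric] times_divide_eq_left mult_1_left)
      then show ?thesis
        using log_one_minus_eq[OF form_type_scalar_mult[OF types(8)[OF that]] N, of c] by simp
    qed
    then have "Del (\<lambda>z. log_one_minus (scalar c * U z)) z = Del (\<lambda>z. - (\<Sum>j<N. ?W j z)) z"
      using z by (intro form_deriv_cong)
    also have "\<dots> = - Del (\<lambda>z. \<Sum>j<N. ?W j z) z"
      using z sW by (intro P.D_uminus smooth_form_sum)
    also have "Del (\<lambda>z. \<Sum>j<N. ?W j z) z = (\<Sum>j<N. Del (?W j) z)"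
      using z sW by (intro P.D_sum) auto
    also have "\<dots> = (\<Sum>j<N. scalar (c ^ Suc j / of_nat (Suc j)) * Del (\<lambda>z. U z ^ Suc j) z)"
      using z by (intro sum.cong refl P.D_cmult smooth_form_power smooth_forms)
    finally show ?thesis .
  qed
  let ?V = "\<lambda>j z. scalar (c ^ Suc j / of_nat (Suc j)) * Del (\<lambda>z. U z ^ Suc j) z"
  have sV: "smooth_form S (?V j)" for j
    by (intro smooth_form_mult smooth_form_form_deriv smooth_form_power smooth_form_const smooth_forms)
  have "Delbar (Del (\<lambda>z. log_one_minus (scalar c * U z))) z = Delbar (\<lambda>z. - (\<Sum>j<N. ?V j z)) z"
    using z Del by (rule form_deriv_cong)
  also have "\<dots> = - Delbar (\<lambda>z. \<Sum>j<N. ?V j z) z"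
    using z sV by (intro Q.D_uminus smooth_form_sum)
  also have "Delbar (\<lambda>z. \<Sum>j<N. ?V j z) z = (\<Sum>j<N. Delbar (?V j) z)"
    using z sV by (intro Q.D_sum) auto
  also have "\<dots> = (\<Sum>j<N. scalar (c ^ Suc j / of_nat (Suc j)) * Delbar (Del (\<lambda>z. U z ^ Suc j)) z)"
    using z by (intro sum.cong refl Q.D_cmult smooth_form_form_deriv smooth_form_power smooth_forms)
  finally show ?thesis .
qed

text \<open>The summand with index j comes from the power j + 1 of \<open>U\<close> and has type (j
  + 2, j + 2), so for k > 1 only j = k - 2 contributes.\<close>

lemma type_part_total_chern:
  assumes z: "z \<in> S" and k: "k \<ge> 1"
  shows "type_part k k (1 + scalar c * Delbar \<eta> z +
      scalar c * Delbar (Del (\<lambda>z. log_one_minus (scalar c * U z))) z) =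
    (if k = 1 then scalar c * Delbar \<eta> z
     else - scalar (1 / (of_nat k - 1) * c ^ k) * Delbar (Del (\<lambda>z. U z ^ (k - 1))) z)"
proof -
  \<comment> \<open>Large enough both for the expansion of the logarithm and for the index k - 2 to
    lie in the range of summation.\<close>
  define N where "N = CARD('n) + k + 1"
  have N: "N > CARD('n)" by (simp add: N_def)
  let ?W = "\<lambda>j. scalar c * (scalar (c ^ Suc j / of_nat (Suc j)) * Delbar (Del (\<lambda>z. U z ^ Suc j)) z)"
  have log: "scalar c * Delbar (Del (\<lambda>z. log_one_minus (scalar c * U z))) z = - (\<Sum>j<N. ?W j)"
    unfolding Delbar_Del_log_sum[OF z N] by (simp only: mult_minus_right sum_distrib_left)
  have "form_type (Suc j + 1) (Suc j + 1) (Delbar (Del (\<lambda>z. U z ^ Suc j)) z)" for j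
  proof -
    have "form_type (Suc j) (Suc j) (U y ^ Suc j)" if "y \<in> S" for y
      using form_type_power[OF types(8)[OF that], of "Suc j"] by simp
    then have "form_type (1 + Suc j) (0 + Suc j) (Del (\<lambda>z. U z ^ Suc j) y)" if "y \<in> S" for y
      using that by (intro P.form_type_D)
    then show ?thesis
      using Q.form_type_D[OF z, of "1 + Suc j" "0 + Suc j"] by simp
  qed
  then have W: "type_part k k (?W j) = (if k = Suc j + 1 then ?W j else 0)" for j
    by (subst type_part_eq[OF form_type_scalar_mult[OF form_type_scalar_mult]]) auto
  have eta: "type_part k k (scalar c * Delbar \<eta> z) = (if k = 1 then scalar c * Delbar \<eta> z else 0)"
    by (subst type_part_eq[OF form_type_scalar_mult[OF types(9)[OF z]]]) simp
  have one: "type_part k k (1 :: 'n cform) = 0"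
    using k by (subst type_part_eq[OF form_type_one]) simp
  have neg: "type_part k k (- x) = - type_part k k x" for x :: "'n cform"
    by (rule cform_eqI) (simp add: type_part_def)
  have "type_part k k (\<Sum>j<N. ?W j) = (if k = 1 then 0 else ?W (k - 2))"
  proof -
    have "type_part k k (\<Sum>j<N. ?W j) = (\<Sum>j<N. if k = Suc j + 1 then ?W j else 0)"
      unfolding type_part_sum W ..
    \<comment> \<open>For k = 1 the truncated subtraction would select j = 0, hence the explicit
      condition.\<close>
    also have "\<dots> = (\<Sum>j<N. if k \<noteq> 1 \<and> j = k - 2 then ?W j else 0)"
      using k by (intro sum.cong refl if_cong) auto
    also have "\<dots> = (if k = 1 then 0 else ?W (k - 2))"
      using k by (auto simp: N_def)
    finally show ?thesis .
  qed
  moreover have "?W (k - 2) = scalar (1 / (of_nat k - 1) * c ^ k) * Delbar (Del (\<lambda>z. U z ^ (k - 1))) z"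
    if "k \<noteq> 1"
  proof -
    define l where "l = k - 2"
    have l: "k - 2 = l" "k - 1 = Suc l" "k = Suc (Suc l)" using k that by (auto simp: l_def)
    have "c * (c ^ Suc l / of_nat (Suc l)) = 1 / (of_nat k - 1) * c ^ k"
      by (simp add: l(3))
    then show ?thesis
      unfolding l(1,2) by (simp only: mult.assoc[symmetric] scalar_mult[symmetric])
  qed
  ultimately show ?thesis
    unfolding log type_part_add eta one neg by (cases "k = 1") (simp_all only: if_True if_False
      minus_zero add_0_left add_0_right mult_minus_left simp_thms)
qed

end

section \<open>From the open set back to the manifold\<close>

lemma del_eq_form_deriv:
  "del \<omega> \<kappa> p = form_deriv (- \<i>) dz (\<lambda>z. \<omega> \<kappa> (chart_inv \<kappa> z)) (chart_map \<kappa> p)"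
  by (simp add: del_def form_deriv_def coord_deriv_def wirtinger_def wirt_def)

lemma delbar_eq_form_deriv:
  "delbar \<omega> \<kappa> p = form_deriv \<i> dzbar (\<lambda>z. \<omega> \<kappa> (chart_inv \<kappa> z)) (chart_map \<kappa> p)"
  by (simp add: delbar_def form_deriv_def coord_deriv_def wirtinger_bar_def wirt_def)

lemma inverse_metric_entry_mult:
  assumes w: "w' * w = 1" and ij: "i \<le> m" "j \<le> m"
  shows "(\<Sum>k<Suc m. inverse_metric_entry m u w' i k * metric_entry m u w k j) = (if i = j then 1 else 0)"
proof (cases "j < m")
  case True
  have "(\<Sum>k<m. inverse_metric_entry m u w' i k * metric_entry m u w k j) =
      (\<Sum>k<m. if k = j then inverse_metric_entry m u w' i j else 0)"
    by (rule sum.cong) (use True in \<open>auto simp: metric_entry_def\<close>)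
  then show ?thesis
    using True ij by (auto simp: inverse_metric_entry_def metric_entry_def)
next
  case False
  then have j: "j = m" using ij by simp
  show ?thesis
  proof (cases "i < m")
    case True
    have "(\<Sum>k<m. inverse_metric_entry m u w' i k * metric_entry m u w k m) =
        (\<Sum>k<m. (if k = i then cnj (u i) else 0) + w' * cnj (u i) * (u k * cnj (u k)))"
      by (rule sum.cong) (use True in \<open>auto simp: metric_entry_def inverse_metric_entry_def algebra_simps\<close>)
    also have "\<dots> = cnj (u i) + w' * cnj (u i) * (\<Sum>k<m. u k * cnj (u k))"
      using True by (simp add: sum.distrib sum_distrib_left)
    finally show ?thesis
      using True w j by (simp add: inverse_metric_entry_def metric_entry_def distrib_left mult.assoc
          mult.left_commute[of "cnj _"])
  next
    case False
    then have i: "i = m" using ij by simp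
    have "(\<Sum>k<m. inverse_metric_entry m u w' m k * metric_entry m u w k m) =
        - (w' * (\<Sum>k<m. u k * cnj (u k)))"
      by (simp add: metric_entry_def inverse_metric_entry_def sum_distrib_left sum_negf mult.assoc)
    then show ?thesis
      using w i j by (simp add: inverse_metric_entry_def metric_entry_def distrib_left)
  qed
qed

text \<open>A left inverse of a square matrix over a field is two-sided, which rules out
  \<open>None\<close>; uniqueness of inverses settles the other case.\<close>

lemma mat_inverse_eq:
  fixes A B :: "'a::field mat"
  assumes A: "A \<in> carrier_mat n n" and B: "B \<in> carrier_mat n n" and BA: "B * A = 1\<^sub>m n"
  shows "mat_inverse A = Some B"
proof (cases "mat_inverse A")
  case None
  have "A * B = 1\<^sub>m n" by (rule mat_mult_left_right_inverse[OF B A BA])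
  then have "A \<in> Units (ring_mat TYPE('a) n ())"
    using A B BA by (auto simp: Units_def ring_mat_def)
  then show ?thesis using mat_inverse(1)[OF A None, of "()"] by blast
next
  case (Some C)
  from mat_inverse(2)[OF A this] have C: "A * C = 1\<^sub>m n" "C \<in> carrier_mat n n" by auto
  have "C = (B * A) * C" using BA C by simp
  also have "\<dots> = B * (A * C)" by (rule assoc_mult_mat[OF B A C(2)])
  finally show ?thesis using Some B C by simp
qed

lemma h_mat_eq:
  "h_mat (Suc m) f \<sigma> p = Matrix.mat (Suc m) (Suc m)
    (\<lambda>(i, j). metric_entry m (\<lambda>i. f (Suc i) p) (of_real (exp (\<sigma> p))) i j)"
proof (rule eq_matI)
  let ?g = "g_mat (Suc m) f \<sigma> p"
  have adj: "mat_adjoint ?g $$ (i, k) = cnj (?g $$ (k, i))" if "i < Suc m" "k < Suc m" for i k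
    using that by (simp add: mat_adjoint_def mat_of_rows_def g_mat_def)
  have dim_g: "dim_row ?g = Suc m" "dim_col ?g = Suc m"
    by (simp_all add: g_mat_def)
  have dim: "dim_row (mat_adjoint ?g) = Suc m" "dim_col (mat_adjoint ?g) = Suc m"
    by (simp_all add: mat_adjoint_def g_mat_def)
  fix i j
  assume "i < dim_row (Matrix.mat (Suc m) (Suc m)
    (\<lambda>(i, j). metric_entry m (\<lambda>i. f (Suc i) p) (of_real (exp (\<sigma> p))) i j))"
    "j < dim_col (Matrix.mat (Suc m) (Suc m)
    (\<lambda>(i, j). metric_entry m (\<lambda>i. f (Suc i) p) (of_real (exp (\<sigma> p))) i j))"
  then have ij: "i < Suc m" "j < Suc m" by auto
  have e: "exp (complex_of_real (\<sigma> p) / 2) * exp (complex_of_real (\<sigma> p) / 2) = exp (complex_of_real (\<sigma> p))"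
    by (simp flip: exp_add)
  have "h_mat (Suc m) f \<sigma> p $$ (i, j) = (\<Sum>k<Suc m. cnj (?g $$ (k, i)) * ?g $$ (k, j))"
    using ij by (simp add: h_mat_def scalar_prod_def dim adj atLeast0LessThan dim_g del: sum.lessThan_Suc)
  also have "\<dots> = (\<Sum>k<m. cnj (?g $$ (k, i)) * ?g $$ (k, j)) + cnj (?g $$ (m, i)) * ?g $$ (m, j)"
    by simp
  also have "(\<Sum>k<m. cnj (?g $$ (k, i)) * ?g $$ (k, j)) =
      (if i < m then if j < m then if i = j then 1 else 0 else cnj (f (Suc i) p)
      else if j < m then f (Suc j) p else (\<Sum>k<m. f (Suc k) p * cnj (f (Suc k) p)))"
  proof -
    have "(\<Sum>k<m. cnj (?g $$ (k, i)) * ?g $$ (k, j)) =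
      (\<Sum>k<m. (if i < m then if k = i then 1 else 0 else f (Suc k) p) *
        (if j < m then if k = j then 1 else 0 else cnj (f (Suc k) p)))"
      by (rule sum.cong) (use ij in \<open>auto simp: g_mat_def\<close>)
    then show ?thesis
      by (auto simp: if_distrib[of "\<lambda>x. x * _"] if_distrib[of "\<lambda>x. _ * x"] cong: if_cong)
  qed
  finally show "h_mat (Suc m) f \<sigma> p $$ (i, j) = Matrix.mat (Suc m) (Suc m)
    (\<lambda>(i, j). metric_entry m (\<lambda>i. f (Suc i) p) (of_real (exp (\<sigma> p))) i j) $$ (i, j)"
    using ij e by (auto simp: metric_entry_def g_mat_def exp_of_real simp flip: of_real_mult exp_add)
qed (simp_all add: h_mat_def g_mat_def mat_adjoint_def)

text \<open>For rank one the matrix g has only its exponential entry, so \<open>f\<close> is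
  arbitrary. The line bundle is thereby covered by the general computation with m = 0.\<close>

lemma line_metric_eq: "line_metric \<sigma> = h_mat (Suc 0) f \<sigma>"
  by (rule ext) (auto simp: h_mat_eq line_metric_def metric_entry_def)

lemma chart_inv_map:
  assumes "complex_manifold X \<A>" "\<kappa> \<in> \<A>" "p \<in> chart_dom \<kappa>"
  shows "chart_inv \<kappa> (chart_map \<kappa> p) = p"
proof -
  have "openin X (chart_dom \<kappa>)"
    "homeomorphic_map (subtopology X (chart_dom \<kappa>)) (top_of_set (chart_image \<kappa>)) (chart_map \<kappa>)"
    using assms(1,2) by (auto simp: complex_manifold_def)
  then have "inj_on (chart_map \<kappa>) (chart_dom \<kappa>)"
    by (metis homeomorphic_imp_injective_map topspace_subtopology_subset openin_subset)
  then show ?thesis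
    using assms(3) by (simp add: chart_inv_def)
qed

lemma chart_map_inv:
  "z \<in> chart_image \<kappa> \<Longrightarrow> chart_inv \<kappa> z \<in> chart_dom \<kappa> \<and> chart_map \<kappa> (chart_inv \<kappa> z) = z"
  unfolding chart_image_def chart_inv_def by (simp add: f_inv_into_f inv_into_into)

lemma chern_in_chart:
  fixes \<A> :: "('a, 'n::{finite,linorder}) chart set"
  assumes X: "complex_manifold X \<A>" and \<kappa>: "\<kappa> \<in> \<A>" and p: "p \<in> chart_dom \<kappa>"
    and f: "\<And>i. 1 \<le> i \<Longrightarrow> i \<le> m \<Longrightarrow> smooth_function \<A> (f i)" and \<sigma>: "smooth_function \<A> \<sigma>"
  shows "total_chern_form (h_mat (Suc m) f \<sigma>) \<kappa> p =
      1 + scalar (\<i> / (2 * of_real pi)) * delbar (del (function_form (\<lambda>q. of_real (\<sigma> q)))) \<kappa> p +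
      scalar (\<i> / (2 * of_real pi)) *
        delbar (del (\<lambda>\<mu> q. log_one_minus (scalar (\<i> / (2 * of_real pi)) * U_form (Suc m) f \<sigma> \<mu> q))) \<kappa> p"
      (is ?total)
    and "k \<ge> 1 \<Longrightarrow> chern_form k (h_mat (Suc m) f \<sigma>) \<kappa> p =
      (if k = 1 then scalar (\<i> / (2 * of_real pi)) * delbar (del (function_form (\<lambda>q. of_real (\<sigma> q)))) \<kappa> p
      else - scalar (1 / (of_nat k - 1) * (\<i> / (2 * of_real pi)) ^ k) *
        delbar (del (\<lambda>\<mu> q. U_form (Suc m) f \<sigma> \<mu> q ^ (k - 1))) \<kappa> p)"
proof -
  let ?c = "\<i> / (2 * of_real pi) :: complex"
  \<comment> \<open>Rows are counted from 0 and the functions from 1, hence the shift by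
    \<open>Suc\<close>.\<close>
  define F where "F i z = f (Suc i) (chart_inv \<kappa> z)" for i z
  define s where "s z = complex_of_real (\<sigma> (chart_inv \<kappa> z))" for z
  interpret bundle_chart "chart_image \<kappa>" m F s
  proof
    show S: "open (chart_image \<kappa>)" using X \<kappa> by (auto simp: complex_manifold_def)
    show "smooth_on (chart_image \<kappa>) (F i)" if "i < m" for i
      using f[of "Suc i"] that \<kappa> by (simp add: smooth_function_def F_def[abs_def] comp_def)
    have "smooth_on (chart_image \<kappa>) (\<lambda>z. \<sigma> (chart_inv \<kappa> z))"
      using \<sigma> \<kappa> by (simp add: smooth_function_def comp_def)
    then show "smooth_on (chart_image \<kappa>) s"
      unfolding s_def[abs_def] by (rule smooth_on_bounded_linear[OF S bounded_linear_of_real])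
  qed
  define z where "z = chart_map \<kappa> p"
  have z: "z \<in> chart_image \<kappa>" using p by (auto simp: z_def chart_image_def)
  have inv: "chart_inv \<kappa> y \<in> chart_dom \<kappa>" "chart_map \<kappa> (chart_inv \<kappa> y) = y" if "y \<in> chart_image \<kappa>" for y
    using chart_map_inv[OF that] by auto
  let ?h = "h_mat (Suc m) f \<sigma>"
  have dim_h: "dim_row (function_mat_form ?h \<kappa> q) = Suc m" "dim_col (function_mat_form ?h \<kappa> q) = Suc m" for q
    by (simp_all add: function_mat_form_def h_mat_eq)
  define H where "H y = Matrix.mat (Suc m) (Suc m)
    (\<lambda>(i, j). inverse_metric_entry m (\<lambda>i. F i y) (exp (- s y)) i j)" for y
  have dim_H: "dim_row (H y) = Suc m" "dim_col (H y) = Suc m" for y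
    by (simp_all add: H_def)
  have inv_h: "mat_inverse (?h q) = Some (H (chart_map \<kappa> q))" if q: "q \<in> chart_dom \<kappa>" for q
  proof -
    let ?y = "chart_map \<kappa> q"
    have q_eq: "chart_inv \<kappa> ?y = q" by (rule chart_inv_map[OF X \<kappa> q])
    have "H ?y * ?h q = 1\<^sub>m (Suc m)"
    proof (rule eq_matI)
      fix i j assume "i < dim_row (1\<^sub>m (Suc m) :: complex mat)" "j < dim_col (1\<^sub>m (Suc m) :: complex mat)"
      then have ij: "i < Suc m" "j < Suc m" by auto
      have "exp (- s ?y) * exp (s ?y) = 1" by (simp flip: exp_add)
      from inverse_metric_entry_mult[OF this, of i m j "\<lambda>i. F i ?y"]
      show "(H ?y * ?h q) $$ (i, j) = 1\<^sub>m (Suc m) $$ (i, j)"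
        using ij by (simp add: H_def h_mat_eq scalar_prod_def F_def s_def q_eq exp_of_real
            atLeast0LessThan del: sum.lessThan_Suc)
    qed (simp_all add: H_def h_mat_eq)
    then show ?thesis
      by (intro mat_inverse_eq[where n = "Suc m"]) (simp_all add: H_def h_mat_eq)
  qed
  have dim_conn: "dim_row (connection_form ?h \<kappa> p) = Suc m" "dim_col (connection_form ?h \<kappa> p) = Suc m"
    by (simp_all add: connection_form_def inv_h[OF p] dim_H del_mat_def dim_h)
  \<comment> \<open>Shown at every point of the chart and not only at \<open>p\<close>, because the
    connection is differentiated next.\<close>
  have conn: "connection_form ?h \<kappa> q $$ (i, j) = conn i j (chart_map \<kappa> q)"
    if q: "q \<in> chart_dom \<kappa>" and ij: "i < Suc m" "j < Suc m" for q i j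
  proof -
    let ?y = "chart_map \<kappa> q"
    have y: "?y \<in> chart_image \<kappa>" using q by (auto simp: chart_image_def)
    have "connection_form ?h \<kappa> q $$ (i, j) = (\<Sum>k<Suc m. scalar (H ?y $$ (i, k)) *
        del (\<lambda>\<mu> q. function_mat_form ?h \<mu> q $$ (k, j)) \<kappa> q)"
      using ij by (simp add: connection_form_def inv_h[OF q] del_mat_def dim_h dim_H scalar_prod_def
          atLeast0LessThan del: sum.lessThan_Suc)
    also have "\<dots> = (\<Sum>k<Suc m. scalar (inverse_metric_entry m (\<lambda>i. F i ?y) (exp (- s ?y)) i k) *
        Del (\<lambda>z. scalar (metric_entry m (\<lambda>i. F i z) (exp (s z)) k j)) ?y)"
      using ij by (intro sum.cong refl arg_cong2[where f = times])
        (simp_all add: H_def del_eq_form_deriv function_mat_form_def h_mat_eq F_def s_def exp_of_real)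
    also have "\<dots> = conn i j ?y"
      using ij by (intro inverse_metric_times_Del_metric y) auto
    finally show ?thesis .
  qed
  have "total_chern_form ?h \<kappa> p = form_det (Matrix.mat (Suc m) (Suc m)
      (\<lambda>(i, j). (if i = j then 1 else 0) + scalar ?c * Delbar (conn i j) z))"
  proof -
    have "delbar (\<lambda>\<mu> q. connection_form ?h \<mu> q $$ (i, j)) \<kappa> p = Delbar (conn i j) z"
      if "i < Suc m" "j < Suc m" for i j
      unfolding delbar_eq_form_deriv z_def[symmetric]
      using z by (rule form_deriv_cong) (simp add: conn inv that)
    then show ?thesis
      unfolding total_chern_form_def
      by (intro arg_cong[where f = form_det] eq_matI)
         (simp_all add: h_mat_eq[of m f \<sigma> p, THEN arg_cong, of dim_row] curvature_form_def delbar_mat_def dim_conn)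
  qed
  also have "\<dots> = 1 + scalar ?c * Delbar \<eta> z +
      scalar ?c * Delbar (Del (\<lambda>z. log_one_minus (scalar ?c * U z))) z"
    by (rule total_chern_chart[OF z])
  finally have total: "total_chern_form ?h \<kappa> p = 1 + scalar ?c * Delbar \<eta> z +
      scalar ?c * Delbar (Del (\<lambda>z. log_one_minus (scalar ?c * U z))) z" .
  \<comment> \<open>The outer operator differentiates the inner one along the whole chart image,
    where \<open>chart_map\<close> undoes \<open>chart_inv\<close>; agreement of the chart
    expressions there suffices.\<close>
  have DD: "delbar (del \<omega>) \<kappa> p = Delbar (Del W) z"
    if "\<And>y. y \<in> chart_image \<kappa> \<Longrightarrow> \<omega> \<kappa> (chart_inv \<kappa> y) = W y" for \<omega> W
    unfolding delbar_eq_form_deriv[of "del \<omega>"] del_eq_form_deriv z_def[symmetric]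
  proof (rule form_deriv_cong[OF z])
    fix y assume y: "y \<in> chart_image \<kappa>"
    show "Del (\<lambda>z. \<omega> \<kappa> (chart_inv \<kappa> z)) (chart_map \<kappa> (chart_inv \<kappa> y)) = Del W y"
      unfolding inv(2)[OF y] using y that by (rule form_deriv_cong)
  qed
  have eta: "delbar (del (function_form (\<lambda>q. of_real (\<sigma> q)))) \<kappa> p = Delbar \<eta> z"
    unfolding \<eta>_def by (rule DD) (simp add: function_form_def s_def)
  have U: "U_form (Suc m) f \<sigma> \<kappa> (chart_inv \<kappa> y) = U y" if "y \<in> chart_image \<kappa>" for y
  proof -
    have "U_form (Suc m) f \<sigma> \<kappa> (chart_inv \<kappa> y) =
        scalar (exp (- s y)) * (\<Sum>i = 1..m. \<alpha> (i - 1) y * \<beta> (i - 1) y)"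
      by (simp add: U_form_def del_eq_form_deriv delbar_eq_form_deriv function_form_def inv that
          s_def exp_of_real \<alpha>_def \<beta>_def v_def F_def flip: of_real_minus)
    also have "(\<Sum>i = 1..m. \<alpha> (i - 1) y * \<beta> (i - 1) y) = (\<Sum>i<m. \<alpha> i y * \<beta> i y)"
      by (rule sum.reindex_bij_witness[where i = Suc and j = "\<lambda>i. i - 1"]) auto
    finally show ?thesis
      by (simp add: U_def a_def sum_distrib_left mult.assoc)
  qed
  show ?total
    unfolding total eta using DD[of "\<lambda>\<mu> q. log_one_minus (scalar ?c * U_form (Suc m) f \<sigma> \<mu> q)"
        "\<lambda>z. log_one_minus (scalar ?c * U z)"] by (simp add: U)
  show "chern_form k ?h \<kappa> p = (if k = 1 then scalar ?c * delbar (del (function_form (\<lambda>q. of_real (\<sigma> q)))) \<kappa> p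
      else - scalar (1 / (of_nat k - 1) * ?c ^ k) *
        delbar (del (\<lambda>\<mu> q. U_form (Suc m) f \<sigma> \<mu> q ^ (k - 1))) \<kappa> p)" if "k \<ge> 1"
    unfolding chern_form_def total type_part_total_chern[OF z that] eta
    using DD[of "\<lambda>\<mu> q. U_form (Suc m) f \<sigma> \<mu> q ^ (k - 1)" "\<lambda>z. U z ^ (k - 1)"] by (simp add: U)
qed

theorem lemma6:
  fixes X :: "'a topology"
    and \<A> :: "('a, 'n::{finite,linorder}) chart set"
    and r :: nat
    and f :: "nat \<Rightarrow> 'a \<Rightarrow> complex"
    and \<sigma> :: "'a \<Rightarrow> real"
  assumes "complex_manifold X \<A>"
    and "r \<ge> 1"
    and "\<And>i. 1 \<le> i \<Longrightarrow> i \<le> r - 1 \<Longrightarrow> smooth_function \<A> (f i)"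
    and "smooth_function \<A> \<sigma>"
  shows "(\<forall>\<kappa>\<in>\<A>. \<forall>p\<in>chart_dom \<kappa>.
        total_chern_form (h_mat r f \<sigma>) \<kappa> p =
          total_chern_form (line_metric \<sigma>) \<kappa> p +
          scalar (\<i> / (2 * of_real pi)) *
            delbar (del (\<lambda>\<mu> q. log_one_minus (scalar (\<i> / (2 * of_real pi)) * U_form r f \<sigma> \<mu> q))) \<kappa> p) \<and>
      (\<forall>\<kappa>\<in>\<A>. \<forall>p\<in>chart_dom \<kappa>.
        chern_form 1 (h_mat r f \<sigma>) \<kappa> p =
          scalar (\<i> / (2 * of_real pi)) *
            delbar (del (function_form (\<lambda>q. of_real (\<sigma> q)))) \<kappa> p) \<and>
      (\<forall>k\<in>{2..r}. \<forall>\<kappa>\<in>\<A>. \<forall>p\<in>chart_dom \<kappa>.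
        chern_form k (h_mat r f \<sigma>) \<kappa> p =
          - scalar (1 / (of_nat k - 1) * (\<i> / (2 * of_real pi)) ^ k) *
            delbar (del (\<lambda>\<mu> q. U_form r f \<sigma> \<mu> q ^ (k - 1))) \<kappa> p)"
proof -
  obtain m where r: "r = Suc m" using assms(2) by (cases r) auto
  have f: "\<And>i. 1 \<le> i \<Longrightarrow> i \<le> m \<Longrightarrow> smooth_function \<A> (f i)" using assms(3) r by simp
  note main = chern_in_chart[OF assms(1) _ _ f assms(4)]
  have line: "total_chern_form (line_metric \<sigma>) \<kappa> p =
      1 + scalar (\<i> / (2 * of_real pi)) * delbar (del (function_form (\<lambda>q. of_real (\<sigma> q)))) \<kappa> p"
    if "\<kappa> \<in> \<A>" "p \<in> chart_dom \<kappa>" for \<kappa> p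
  proof -
    have U: "U_form (Suc 0) f \<sigma> \<mu> q = 0" for \<mu> :: "('a, 'n) chart" and q
      by (simp add: U_form_def)
    \<comment> \<open>In rank one U is an empty sum, so the logarithm is taken of a constant form
      and its derivatives vanish whatever its value.\<close>
    have const: "form_deriv e \<theta> (\<lambda>z. w) y = 0" for e \<theta> w and y :: "(complex, 'n) Finite_Cartesian_Product.vec"
      by (simp add: form_deriv_def coord_deriv_def) (simp flip: zero_cform_def)
    have "delbar (del (\<lambda>\<mu> q. log_one_minus (scalar c * U_form (Suc 0) f \<sigma> \<mu> q))) \<kappa> p = 0" for c
      unfolding U delbar_eq_form_deriv del_eq_form_deriv const ..
    then show ?thesis
      unfolding line_metric_eq[of \<sigma> f]
      using chern_in_chart(1)[OF assms(1) that _ assms(4), of 0 f] by simp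
  qed
  show ?thesis
    unfolding r using main line by auto
qed

end
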